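(* Let $Q$ be an acyclic quiver, let $v\in Q_0$ be a source, and let $\mathbf{d}\in\mathbb{Z}_{\geq 0}^{Q_0}$ with $d_v=d$. Let $\overline{Q}_0:=Q_0$ and let $\overline{\mathbf{d}}\in\mathbb{Z}_{\geq 0}^{\overline{Q}_0}$ be given by $\overline{d}_v=1$ and $\overline{d}_i=d_i$ for all $i\neq v$. Let $\mathcal{A}:=\{\alpha\in Q_1 \mid s(\alpha)=v\}$, let $\overline{\mathcal{A}}:=\{\alpha^1,\dots,\alpha^d \mid \alpha\in\mathcal{A}\}$ consist of $d$ duplicates of each $\alpha\in\mathcal{A}$ (each $\alpha^k$ being an arrow with the same source and target as $\alpha$; $\overline{\mathcal{A}}=\varnothing$ if $d=0$), and let $\overline{Q}_1:=(Q_1\setminus\mathcal{A})\cup\overline{\mathcal{A}}$, giving the quiver $\overline{Q}:=(\overline{Q}_0,\overline{Q}_1)$. Then $\operatorname{rad}A_{Q,\mathbf{d}}\cong\operatorname{rad}A_{\overline{Q},\overline{\mathbf{d}}}$ (as ideals, in the sense defined in the context). In particular, $[Q,\mathbf{d}]=[\overline{Q},\overline{\mathbf{d}}]$.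
   Context: Let $\mathbb{k}=\mathbb{F}_q$ be a finite field. A quiver $Q=(Q_0,Q_1)$ consists of a finite set $Q_0$ of vertices and a finite set $Q_1$ of arrows, each arrow $\alpha$ having a source $s(\alpha)$ and a target $t(\alpha)$ in $Q_0$; multiple arrows are allowed. $Q$ is acyclic if it has no oriented cycles. A source is a vertex that is the target of no arrow; a sink is a vertex that is the source of no arrow. Paths are written left to right ($cp$ means first $c$, then $p$). For a vertex $i$, $P_Q(i)$ is the indecomposable projective representation of $Q$ over $\mathbb{k}$ at $i$: its space at vertex $j$ has as basis the set of all paths from $i$ to $j$ (including the constant path $e_i$ if $j=i$), and an arrow $\alpha:j\to k$ acts by $c\mapsto c\alpha$. For a summand vector $\mathbf{d}\in\mathbb{Z}_{\geq 0}^{Q_0}$, $P_{Q,\mathbf{d}}:=\bigoplus_{i\in Q_0}P_Q(i)^{d_i}$ and $A_{Q,\mathbf{d}}:=\operatorname{End}(P_{Q,\mathbf{d}})$ is its endomorphism algebra in the category of representations of $Q$ over $\mathbb{k}$. $\operatorname{rad}$ denotes the Jacobson radical. The count $[Q,\mathbf{d}]$ is the number of pairs $(x,y)\in\operatorname{rad}A_{Q,\mathbf{d}}\times\operatorname{rad}A_{Q,\mathbf{d}}$ with $xy=yx$. Two-sided ideals $I\unlhd A$, $J\unlhd B$ of $\mathbb{k}$-algebras are called isomorphic, $I\cong J$, if there is a bijective $\mathbb{k}$-linear map $\Psi:I\to J$ with $\Psi(i_1 i_2)=\Psi(i_1)\Psi(i_2)$ for all $i_1,i_2\in I$. *)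

theory Defs
  imports "Graph_Theory.Digraph" "Graph_Theory.Arc_Walk"
    "HOL-Algebra.Ideal" "HOL-Algebra.Module"
    "HOL-Library.FuncSet" "HOL-Library.Function_Algebras"
begin

section \<open>Quivers\<close>

text \<open>A quiver is a finite directed multigraph, \<^const>\<open>fin_digraph\<close>; paths are the
  walks \<^const>\<open>pre_digraph.awalk\<close>, given by their lists of arrows in left-to-right order.
  The constant path at \<open>i\<close> is the empty list, seen as a walk from \<open>i\<close> to \<open>i\<close>.
  Note that \<^const>\<open>pre_digraph.cycle\<close> counts loops as cycles.\<close>

definition acyclic_quiver :: "('v, 'a) pre_digraph \<Rightarrow> bool" where
  "acyclic_quiver Q \<longleftrightarrow> (\<nexists>p. pre_digraph.cycle Q p)"

definition source_vertex :: "('v, 'a) pre_digraph \<Rightarrow> 'v \<Rightarrow> bool" where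
  "source_vertex Q v \<longleftrightarrow> v \<in> verts Q \<and> in_arcs Q v = {}"

text \<open>Replace every arrow starting at \<open>v\<close> by \<open>n\<close> copies of itself: \<open>Inr (\<alpha>, k)\<close> is the
  \<open>k\<close>-th copy of \<open>\<alpha>\<close>, and \<open>Inl \<alpha>\<close> is an arrow \<open>\<alpha>\<close> that is kept.\<close>

definition dup_quiver :: "('v, 'a) pre_digraph \<Rightarrow> 'v \<Rightarrow> nat \<Rightarrow> ('v, 'a + 'a \<times> nat) pre_digraph" where
  "dup_quiver Q v n =
     \<lparr> verts = verts Q,
       arcs = Inl ` (arcs Q - out_arcs Q v) \<union> Inr ` (out_arcs Q v \<times> {1..n}),
       tail = case_sum (tail Q) (\<lambda>(\<alpha>, k). tail Q \<alpha>),
       head = case_sum (head Q) (\<lambda>(\<alpha>, k). head Q \<alpha>) \<rparr>"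


section \<open>Representations\<close>

text \<open>The vertex spaces are subspaces of an ambient type \<open>'m\<close>; only the restriction of
  \<open>arr_map V \<alpha>\<close> to the space at the tail of \<open>\<alpha>\<close> matters.\<close>

record ('k, 'v, 'a, 'm) quiver_rep =
  vspace :: "'v \<Rightarrow> 'm set"
  arr_map :: "'a \<Rightarrow> 'm \<Rightarrow> 'm"
  scale :: "'k \<Rightarrow> 'm \<Rightarrow> 'm"

definition is_rep ::
  "('v, 'a) pre_digraph \<Rightarrow> ('k::field, 'v, 'a, 'm::ab_group_add) quiver_rep \<Rightarrow> bool" where
  "is_rep Q V \<longleftrightarrow>
     (\<forall>j\<in>verts Q. 0 \<in> vspace V j \<and>
        (\<forall>x\<in>vspace V j. \<forall>y\<in>vspace V j. x + y \<in> vspace V j) \<and>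
        (\<forall>c. \<forall>x\<in>vspace V j. scale V c x \<in> vspace V j) \<and>
        (\<forall>c. \<forall>x\<in>vspace V j. \<forall>y\<in>vspace V j. scale V c (x + y) = scale V c x + scale V c y) \<and>
        (\<forall>b c. \<forall>x\<in>vspace V j. scale V (b + c) x = scale V b x + scale V c x) \<and>
        (\<forall>b c. \<forall>x\<in>vspace V j. scale V (b * c) x = scale V b (scale V c x)) \<and>
        (\<forall>x\<in>vspace V j. scale V 1 x = x)) \<and>
     (\<forall>\<alpha>\<in>arcs Q.
        (\<forall>x\<in>vspace V (tail Q \<alpha>). arr_map V \<alpha> x \<in> vspace V (head Q \<alpha>)) \<and>
        (\<forall>x\<in>vspace V (tail Q \<alpha>). \<forall>y\<in>vspace V (tail Q \<alpha>).
           arr_map V \<alpha> (x + y) = arr_map V \<alpha> x + arr_map V \<alpha> y) \<and>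
        (\<forall>c. \<forall>x\<in>vspace V (tail Q \<alpha>). arr_map V \<alpha> (scale V c x) = scale V c (arr_map V \<alpha> x)))"

definition rep_hom ::
  "('v, 'a) pre_digraph \<Rightarrow> ('k::field, 'v, 'a, 'm::ab_group_add) quiver_rep \<Rightarrow>
   ('k, 'v, 'a, 'n::ab_group_add) quiver_rep \<Rightarrow> ('v \<Rightarrow> 'm \<Rightarrow> 'n) set" where
  "rep_hom Q V W =
     {\<phi> \<in> (\<Pi>\<^sub>E j\<in>verts Q. vspace V j \<rightarrow>\<^sub>E vspace W j).
        (\<forall>j\<in>verts Q. \<forall>x\<in>vspace V j. \<forall>y\<in>vspace V j. \<phi> j (x + y) = \<phi> j x + \<phi> j y) \<and>
        (\<forall>j\<in>verts Q. \<forall>c. \<forall>x\<in>vspace V j. \<phi> j (scale V c x) = scale W c (\<phi> j x)) \<and>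
        (\<forall>\<alpha>\<in>arcs Q. \<forall>x\<in>vspace V (tail Q \<alpha>).
           \<phi> (head Q \<alpha>) (arr_map V \<alpha> x) = arr_map W \<alpha> (\<phi> (tail Q \<alpha>) x))}"

definition end_algebra ::
  "('v, 'a) pre_digraph \<Rightarrow> ('k::field, 'v, 'a, 'm::ab_group_add) quiver_rep \<Rightarrow>
   ('k, 'v \<Rightarrow> 'm \<Rightarrow> 'm) module" where
  "end_algebra Q V =
     \<lparr> carrier = rep_hom Q V V,
       mult = (\<lambda>\<phi> \<psi>. \<lambda>j\<in>verts Q. compose (vspace V j) (\<phi> j) (\<psi> j)),
       one = (\<lambda>j\<in>verts Q. \<lambda>x\<in>vspace V j. x),
       zero = (\<lambda>j\<in>verts Q. \<lambda>x\<in>vspace V j. 0),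
       add = (\<lambda>\<phi> \<psi>. \<lambda>j\<in>verts Q. \<lambda>x\<in>vspace V j. \<phi> j x + \<psi> j x),
       smult = (\<lambda>c \<phi>. \<lambda>j\<in>verts Q. \<lambda>x\<in>vspace V j. scale V c (\<phi> j x)) \<rparr>"

definition rep_direct_sum ::
  "'s set \<Rightarrow> ('s \<Rightarrow> ('k::field, 'v, 'a, 'm::ab_group_add) quiver_rep) \<Rightarrow>
   ('k, 'v, 'a, 's \<Rightarrow> 'm) quiver_rep" where
  "rep_direct_sum S V =
     \<lparr> vspace = (\<lambda>j. {x. (\<forall>s\<in>S. x s \<in> vspace (V s) j) \<and> (\<forall>s. s \<notin> S \<longrightarrow> x s = 0) \<and>
                        finite {s. x s \<noteq> 0}}),
       arr_map = (\<lambda>\<alpha> x s. if s \<in> S then arr_map (V s) \<alpha> (x s) else 0),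
       scale = (\<lambda>c x s. if s \<in> S then scale (V s) c (x s) else 0) \<rparr>"


section \<open>Projective representations and their endomorphism algebras\<close>

text \<open>The space with basis \<open>B\<close> consists of the finitely supported coefficient functions
  vanishing outside \<open>B\<close>; \<open>lin_extend g\<close> is the linear extension of the map \<open>g\<close> on
  basis elements.\<close>

definition free_space :: "'b set \<Rightarrow> ('b \<Rightarrow> 'k::field) set" where
  "free_space B = {f. finite {b. f b \<noteq> 0} \<and> (\<forall>b. b \<notin> B \<longrightarrow> f b = 0)}"

definition lin_extend :: "('b \<Rightarrow> 'c) \<Rightarrow> ('b \<Rightarrow> 'k::field) \<Rightarrow> ('c \<Rightarrow> 'k)" where
  "lin_extend g f = (\<lambda>c. \<Sum>b | f b \<noteq> 0. f b * (if c = g b then 1 else 0))"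

definition proj_rep ::
  "('v, 'a) pre_digraph \<Rightarrow> 'v \<Rightarrow> ('k::field, 'v, 'a, 'a list \<Rightarrow> 'k) quiver_rep" where
  "proj_rep Q i =
     \<lparr> vspace = (\<lambda>j. free_space {p. pre_digraph.awalk Q i p j}),
       arr_map = (\<lambda>\<alpha>. lin_extend (\<lambda>p. p @ [\<alpha>])),
       scale = (\<lambda>c f p. c * f p) \<rparr>"

text \<open>The index \<open>(i, k)\<close> is the \<open>k\<close>-th of the \<open>d i\<close> copies of the projective at \<open>i\<close>.\<close>

definition proj_sum ::
  "('v, 'a) pre_digraph \<Rightarrow> ('v \<Rightarrow> nat) \<Rightarrow>
   ('k::field, 'v, 'a, 'v \<times> nat \<Rightarrow> 'a list \<Rightarrow> 'k) quiver_rep" where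
  "proj_sum Q d = rep_direct_sum (SIGMA i:verts Q. {1..d i}) (\<lambda>(i, k). proj_rep Q i)"

definition proj_end ::
  "'k::field itself \<Rightarrow> ('v, 'a) pre_digraph \<Rightarrow> ('v \<Rightarrow> nat) \<Rightarrow>
   ('k, 'v \<Rightarrow> ('v \<times> nat \<Rightarrow> 'a list \<Rightarrow> 'k) \<Rightarrow> ('v \<times> nat \<Rightarrow> 'a list \<Rightarrow> 'k)) module" where
  "proj_end K Q d = end_algebra Q (proj_sum Q d)"


section \<open>Jacobson radical, isomorphism of ideals, commuting pairs\<close>

definition left_ideal :: "'e set \<Rightarrow> ('e, 'm) ring_scheme \<Rightarrow> bool" where
  "left_ideal I R \<longleftrightarrow>
     additive_subgroup I R \<and> (\<forall>r\<in>carrier R. \<forall>x\<in>I. r \<otimes>\<^bsub>R\<^esub> x \<in> I)"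

definition maximal_left_ideal :: "'e set \<Rightarrow> ('e, 'm) ring_scheme \<Rightarrow> bool" where
  "maximal_left_ideal I R \<longleftrightarrow> left_ideal I R \<and> I \<noteq> carrier R \<and>
     (\<forall>J. left_ideal J R \<and> I \<subseteq> J \<longrightarrow> J = I \<or> J = carrier R)"

definition jacobson_radical :: "('e, 'm) ring_scheme \<Rightarrow> 'e set" where
  "jacobson_radical R = {x \<in> carrier R. \<forall>I. maximal_left_ideal I R \<longrightarrow> x \<in> I}"

definition ideal_iso ::
  "('k, 'e) module \<Rightarrow> 'e set \<Rightarrow> ('k, 'f) module \<Rightarrow> 'f set \<Rightarrow> bool" where
  "ideal_iso A I B J \<longleftrightarrow> ideal I A \<and> ideal J B \<and>
     (\<exists>\<Psi>. bij_betw \<Psi> I J \<and>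
        (\<forall>x\<in>I. \<forall>y\<in>I. \<Psi> (x \<oplus>\<^bsub>A\<^esub> y) = \<Psi> x \<oplus>\<^bsub>B\<^esub> \<Psi> y) \<and>
        (\<forall>c. \<forall>x\<in>I. \<Psi> (c \<odot>\<^bsub>A\<^esub> x) = c \<odot>\<^bsub>B\<^esub> \<Psi> x) \<and>
        (\<forall>x\<in>I. \<forall>y\<in>I. \<Psi> (x \<otimes>\<^bsub>A\<^esub> y) = \<Psi> x \<otimes>\<^bsub>B\<^esub> \<Psi> y))"

definition commuting_count ::
  "'k::{field, finite} itself \<Rightarrow> ('v, 'a) pre_digraph \<Rightarrow> ('v \<Rightarrow> nat) \<Rightarrow> nat" where
  "commuting_count K Q d =
     card {(x, y). x \<in> jacobson_radical (proj_end K Q d) \<and> y \<in> jacobson_radical (proj_end K Q d) \<and>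
                   x \<otimes>\<^bsub>proj_end K Q d\<^esub> y = y \<otimes>\<^bsub>proj_end K Q d\<^esub> x}"


section \<open>The projectives are representations and their endomorphisms form a ring\<close>

lemma lin_extend_sup:
  assumes "finite S" "{b. f b \<noteq> 0} \<subseteq> S"
  shows "lin_extend g f = (\<lambda>c. \<Sum>b\<in>S. f b * (if c = g b then 1 else 0))"
  unfolding lin_extend_def
  by (rule ext, rule sum.mono_neutral_left) (use assms in auto)

lemma lin_extend_add:
  assumes "finite {b. f b \<noteq> 0}" "finite {b. h b \<noteq> 0}"
  shows "lin_extend g (f + h) = lin_extend g f + lin_extend g h"
proof -
  let ?S = "{b. f b \<noteq> 0} \<union> {b. h b \<noteq> 0}"
  have fin: "finite ?S" using assms by simp
  show ?thesis
    by (subst (1 2 3) lin_extend_sup[OF fin])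
       (auto simp: fun_eq_iff sum.distrib distrib_right)
qed

lemma lin_extend_scale:
  assumes "finite {b. f b \<noteq> 0}"
  shows "lin_extend g (\<lambda>p. c * f p) = (\<lambda>p. c * lin_extend g f p)"
  by (subst (1 2) lin_extend_sup[OF assms]) (auto simp: fun_eq_iff sum_distrib_left mult.assoc)

lemma lin_extend_free_space:
  assumes "f \<in> free_space B" "g ` B \<subseteq> C"
  shows "lin_extend g f \<in> free_space C"
proof -
  have fin: "finite {b. f b \<noteq> 0}" using assms by (simp add: free_space_def)
  have "lin_extend g f c = 0" if "c \<notin> g ` {b. f b \<noteq> 0}" for c
    unfolding lin_extend_def by (rule sum.neutral) (use that in auto)
  then have sub: "{c. lin_extend g f c \<noteq> 0} \<subseteq> g ` {b. f b \<noteq> 0}" by blast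
  moreover have "{b. f b \<noteq> 0} \<subseteq> B" using assms by (auto simp: free_space_def)
  ultimately show ?thesis
    using assms(2) finite_subset[OF sub] fin unfolding free_space_def by blast
qed

lemma free_space_add: "f \<in> free_space B \<Longrightarrow> h \<in> free_space B \<Longrightarrow> f + h \<in> free_space B"
  unfolding free_space_def
  by (auto intro: finite_subset[of _ "{b. f b \<noteq> 0} \<union> {b. h b \<noteq> 0}"])

lemma free_space_scale: "f \<in> free_space B \<Longrightarrow> (\<lambda>p. c * f p) \<in> free_space B"
  unfolding free_space_def
  by (auto intro: finite_subset[of _ "{b. f b \<noteq> 0}"])

lemma is_rep_proj_rep:
  fixes Q :: "('v, 'a) pre_digraph"
  assumes "wf_digraph Q"
  shows "is_rep Q (proj_rep Q i :: ('k::field, 'v, 'a, 'a list \<Rightarrow> 'k) quiver_rep)"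
proof -
  interpret wf_digraph Q by fact
  have step: "(\<lambda>p. p @ [\<alpha>]) ` {p. awalk i p (tail Q \<alpha>)} \<subseteq> {p. awalk i p (head Q \<alpha>)}"
    if "\<alpha> \<in> arcs Q" for \<alpha>
    using that by (auto simp: awalk_appendI arc_implies_awalk)
  let ?P = "proj_rep Q i :: ('k, 'v, 'a, 'a list \<Rightarrow> 'k) quiver_rep"
  show ?thesis
    unfolding is_rep_def
  proof (intro conjI ballI allI)
    fix j assume "j \<in> verts Q"
    show "0 \<in> vspace (?P) j" by (simp add: proj_rep_def free_space_def)
    fix x :: "'a list \<Rightarrow> 'k" assume x: "x \<in> vspace (?P) j"
    show "scale (?P) c x \<in> vspace (?P) j" for c
      using x by (simp add: proj_rep_def free_space_scale)
    show "scale (?P) (b + c) x = scale (?P) b x + scale (?P) c x" for b c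
      by (simp add: proj_rep_def fun_eq_iff distrib_right)
    show "scale (?P) (b * c) x = scale (?P) b (scale (?P) c x)" for b c
      by (simp add: proj_rep_def fun_eq_iff mult.assoc)
    show "scale (?P) 1 x = x" by (simp add: proj_rep_def)
    fix y :: "'a list \<Rightarrow> 'k" assume y: "y \<in> vspace (?P) j"
    show "x + y \<in> vspace (?P) j" using x y by (simp add: proj_rep_def free_space_add)
    show "scale (?P) c (x + y) = scale (?P) c x + scale (?P) c y" for c
      by (simp add: proj_rep_def fun_eq_iff distrib_left)
  next
    fix \<alpha> and x :: "'a list \<Rightarrow> 'k" assume \<alpha>: "\<alpha> \<in> arcs Q" and x: "x \<in> vspace (?P) (tail Q \<alpha>)"
    have x': "x \<in> free_space {p. awalk i p (tail Q \<alpha>)}" using x by (simp add: proj_rep_def)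
    then have fx: "finite {b. x b \<noteq> 0}" by (simp add: free_space_def)
    show "arr_map (?P) \<alpha> x \<in> vspace (?P) (head Q \<alpha>)"
      using lin_extend_free_space[OF x' step[OF \<alpha>]] by (simp add: proj_rep_def)
    show "arr_map (?P) \<alpha> (scale (?P) c x) = scale (?P) c (arr_map (?P) \<alpha> x)" for c
      using lin_extend_scale[OF fx] by (simp add: proj_rep_def)
    fix y :: "'a list \<Rightarrow> 'k" assume y: "y \<in> vspace (?P) (tail Q \<alpha>)"
    have fy: "finite {b. y b \<noteq> 0}" using y by (simp add: proj_rep_def free_space_def)
    show "arr_map (?P) \<alpha> (x + y) = arr_map (?P) \<alpha> x + arr_map (?P) \<alpha> y"
      using lin_extend_add[OF fx fy] by (simp add: proj_rep_def)
  qed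
qed

lemma is_repD:
  assumes "is_rep Q V"
  shows "j \<in> verts Q \<Longrightarrow> 0 \<in> vspace V j"
    "j \<in> verts Q \<Longrightarrow> x \<in> vspace V j \<Longrightarrow> y \<in> vspace V j \<Longrightarrow> x + y \<in> vspace V j"
    "j \<in> verts Q \<Longrightarrow> x \<in> vspace V j \<Longrightarrow> scale V c x \<in> vspace V j"
    "j \<in> verts Q \<Longrightarrow> x \<in> vspace V j \<Longrightarrow> y \<in> vspace V j \<Longrightarrow> scale V c (x + y) = scale V c x + scale V c y"
    "j \<in> verts Q \<Longrightarrow> x \<in> vspace V j \<Longrightarrow> scale V (b + c) x = scale V b x + scale V c x"
    "j \<in> verts Q \<Longrightarrow> x \<in> vspace V j \<Longrightarrow> scale V (b * c) x = scale V b (scale V c x)"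
    "j \<in> verts Q \<Longrightarrow> x \<in> vspace V j \<Longrightarrow> scale V 1 x = x"
    "\<alpha> \<in> arcs Q \<Longrightarrow> x \<in> vspace V (tail Q \<alpha>) \<Longrightarrow> arr_map V \<alpha> x \<in> vspace V (head Q \<alpha>)"
    "\<alpha> \<in> arcs Q \<Longrightarrow> x \<in> vspace V (tail Q \<alpha>) \<Longrightarrow> y \<in> vspace V (tail Q \<alpha>) \<Longrightarrow>
       arr_map V \<alpha> (x + y) = arr_map V \<alpha> x + arr_map V \<alpha> y"
    "\<alpha> \<in> arcs Q \<Longrightarrow> x \<in> vspace V (tail Q \<alpha>) \<Longrightarrow> arr_map V \<alpha> (scale V c x) = scale V c (arr_map V \<alpha> x)"
  using assms unfolding is_rep_def by simp_all

lemma is_rep_scale_0: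
  assumes "is_rep Q V" "j \<in> verts Q" shows "scale V c 0 = 0"
proof -
  have "scale V c (0 + 0) = scale V c 0 + scale V c 0" using assms unfolding is_rep_def by blast
  then show ?thesis by simp
qed

lemma is_rep_arr_0:
  assumes "is_rep Q V" "a \<in> arcs Q" "wf_digraph Q" shows "arr_map V a 0 = 0"
proof -
  have "tail Q a \<in> verts Q" using assms by (simp add: wf_digraph.tail_in_verts)
  then have "arr_map V a (0 + 0) = arr_map V a 0 + arr_map V a 0" using assms unfolding is_rep_def by blast
  then show ?thesis by simp
qed

lemma is_rep_direct_sum:
  fixes V :: "'s \<Rightarrow> ('k::field, 'v, 'a, 'm::ab_group_add) quiver_rep"
  assumes wf: "wf_digraph Q" and "\<And>s. s \<in> S \<Longrightarrow> is_rep Q (V s)"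
  shows "is_rep Q (rep_direct_sum S V)"
proof -
  have F: "finite {s. x s + y s \<noteq> (0::'m)}" if "finite {s. x s \<noteq> 0}" "finite {s. y s \<noteq> 0}" for x y :: "'s \<Rightarrow> 'm"
    by (rule finite_subset[of _ "{s. x s \<noteq> 0} \<union> {s. y s \<noteq> 0}"]) (use that in auto)
  note D = is_repD[OF assms(2)]
  let ?D = "rep_direct_sum S V"
  have v: "x \<in> vspace ?D j \<longleftrightarrow> (\<forall>s\<in>S. x s \<in> vspace (V s) j) \<and> (\<forall>s. s \<notin> S \<longrightarrow> x s = 0) \<and> finite {s. x s \<noteq> 0}" for x j
    by (simp add: rep_direct_sum_def)
  have a: "arr_map ?D a x s = (if s \<in> S then arr_map (V s) a (x s) else 0)" for a x s
    by (simp add: rep_direct_sum_def)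
  have c: "scale ?D c x s = (if s \<in> S then scale (V s) c (x s) else 0)" for c x s
    by (simp add: rep_direct_sum_def)
  show ?thesis
    unfolding is_rep_def
  proof (intro conjI ballI allI)
    fix j assume j: "j \<in> verts Q"
    show "0 \<in> vspace ?D j" by (simp add: v D(1)[OF _ j])
    fix x assume x: "x \<in> vspace ?D j"
    have xs: "x s \<in> vspace (V s) j" if "s \<in> S" for s using x that by (simp add: v)
    have x0: "x s = 0" if "s \<notin> S" for s using x that by (simp add: v)
    show "scale ?D 1 x = x" by (rule ext) (simp add: c x0 D(7)[OF _ j xs])
    fix k
    have "finite {s. scale ?D k x s \<noteq> 0}"
      by (rule finite_subset[of _ "{s. x s \<noteq> 0}"])
         (use x in \<open>auto simp: v c is_rep_scale_0[OF assms(2) j] split: if_splits\<close>)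
    then show "scale ?D k x \<in> vspace ?D j" by (simp add: v) (simp add: c D(3)[OF _ j xs])
    fix l
    show "scale ?D (k + l) x = scale ?D k x + scale ?D l x"
      by (rule ext) (simp add: c D(5)[OF _ j xs])
    show "scale ?D (k * l) x = scale ?D k (scale ?D l x)"
      by (rule ext) (simp add: c D(6)[OF _ j xs])
  next
    fix j x y k assume j: "j \<in> verts Q" and x: "x \<in> vspace ?D j" and y: "y \<in> vspace ?D j"
    have xs: "x s \<in> vspace (V s) j" "y s \<in> vspace (V s) j" if "s \<in> S" for s using x y that by (simp_all add: v)
    show "scale ?D k (x + y) = scale ?D k x + scale ?D k y"
      by (rule ext) (simp add: c D(4)[OF _ j xs])
  next
    fix j x y assume j: "j \<in> verts Q" and x: "x \<in> vspace ?D j" and y: "y \<in> vspace ?D j"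
    have xs: "x s \<in> vspace (V s) j" "y s \<in> vspace (V s) j" if "s \<in> S" for s using x y that by (simp_all add: v)
    show "x + y \<in> vspace ?D j" using x y F[of x y] by (simp add: v D(2)[OF _ j xs])
  next
    fix \<alpha> x assume \<alpha>: "\<alpha> \<in> arcs Q" and x: "x \<in> vspace ?D (tail Q \<alpha>)"
    have xs: "x s \<in> vspace (V s) (tail Q \<alpha>)" if "s \<in> S" for s using x that by (simp add: v)
    have "finite {s. arr_map ?D \<alpha> x s \<noteq> 0}"
      by (rule finite_subset[of _ "{s. x s \<noteq> 0}"])
         (use x in \<open>auto simp: v a is_rep_arr_0[OF assms(2) \<alpha> wf] split: if_splits\<close>)
    then show "arr_map ?D \<alpha> x \<in> vspace ?D (head Q \<alpha>)"
      by (simp add: v) (simp add: a D(8)[OF _ \<alpha> xs])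
    fix k show "arr_map ?D \<alpha> (scale ?D k x) = scale ?D k (arr_map ?D \<alpha> x)"
      by (rule ext) (simp add: a c D(10)[OF _ \<alpha> xs])
  next
    fix \<alpha> x y assume \<alpha>: "\<alpha> \<in> arcs Q" and x: "x \<in> vspace ?D (tail Q \<alpha>)" "y \<in> vspace ?D (tail Q \<alpha>)"
    have xs: "x s \<in> vspace (V s) (tail Q \<alpha>)" "y s \<in> vspace (V s) (tail Q \<alpha>)" if "s \<in> S" for s using x that by (simp_all add: v)
    show "arr_map ?D \<alpha> (x + y) = arr_map ?D \<alpha> x + arr_map ?D \<alpha> y"
      by (rule ext) (simp add: a D(9)[OF _ \<alpha> xs])
  qed
qed

lemma is_rep_proj_sum: "wf_digraph Q \<Longrightarrow> is_rep Q (proj_sum Q d)"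
  unfolding proj_sum_def by (rule is_rep_direct_sum) (auto intro: is_rep_proj_rep)

lemma rep_hom_in: "\<phi> \<in> rep_hom Q V W \<Longrightarrow> j \<in> verts Q \<Longrightarrow> x \<in> vspace V j \<Longrightarrow> \<phi> j x \<in> vspace W j"
  unfolding rep_hom_def by (auto simp: PiE_iff)

lemma rep_homI:
  assumes "\<And>j x. j \<in> verts Q \<Longrightarrow> x \<in> vspace V j \<Longrightarrow> f j x \<in> vspace W j"
   "\<And>j x y. j \<in> verts Q \<Longrightarrow> x \<in> vspace V j \<Longrightarrow> y \<in> vspace V j \<Longrightarrow> f j (x + y) = f j x + f j y"
   "\<And>j c x. j \<in> verts Q \<Longrightarrow> x \<in> vspace V j \<Longrightarrow> f j (scale V c x) = scale W c (f j x)"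
   "\<And>\<alpha> x. \<alpha> \<in> arcs Q \<Longrightarrow> x \<in> vspace V (tail Q \<alpha>) \<Longrightarrow> f (head Q \<alpha>) (arr_map V \<alpha> x) = arr_map W \<alpha> (f (tail Q \<alpha>) x)"
   "is_rep Q V" "wf_digraph Q"
 shows "(\<lambda>j\<in>verts Q. \<lambda>x\<in>vspace V j. f j x) \<in> rep_hom Q V W"
  unfolding rep_hom_def
  by (auto simp: assms(1-4) is_repD[OF assms(5)] wf_digraph.tail_in_verts[OF assms(6)] wf_digraph.head_in_verts[OF assms(6)])

lemma rep_hom_ext: "\<phi> \<in> rep_hom Q V W \<Longrightarrow> \<psi> \<in> rep_hom Q V W \<Longrightarrow> (\<And>j x. j \<in> verts Q \<Longrightarrow> x \<in> vspace V j \<Longrightarrow> \<phi> j x = \<psi> j x) \<Longrightarrow> \<phi> = \<psi>"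
  unfolding rep_hom_def
  apply (rule ext, rule ext)
  subgoal for j x
    apply (cases "j \<in> verts Q"; cases "x \<in> vspace V j")
    apply (auto simp: PiE_iff extensional_def)
    done
  done

lemma ring_end_algebra:
  assumes "is_rep Q V" "wf_digraph Q"
  shows "ring (end_algebra Q V)"
proof -
  interpret wf_digraph Q by fact
  note R = is_repD[OF assms(1)]
  note H = rep_hom_def[of Q V V]
  have neg: "- x = scale V (-1) x" if "j \<in> verts Q" "x \<in> vspace V j" for j x
  proof -
    have "scale V (1 + -1) x = scale V 1 x + scale V (-1) x" "scale V 1 x = x"
      "scale V (0+0) x = scale V 0 x + scale V 0 x" using R(5,7) that by blast+
    then show ?thesis by (simp add: minus_unique)
  qed
  have z0: "arr_map V a 0 = 0" if "a \<in> arcs Q" for a by (rule is_rep_arr_0[OF assms(1) that assms(2)])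
  have s0: "scale V c 0 = 0" if "j \<in> verts Q" for c j by (rule is_rep_scale_0[OF assms(1) that])
  have zc: "(\<lambda>j\<in>verts Q. \<lambda>x\<in>vspace V j. 0) \<in> rep_hom Q V V"
    by (rule rep_homI) (use R z0 s0 assms in auto)
  have oc: "(\<lambda>j\<in>verts Q. \<lambda>x\<in>vspace V j. x) \<in> rep_hom Q V V"
    by (rule rep_homI) (use assms in auto)
  have ac: "(\<lambda>j\<in>verts Q. \<lambda>x\<in>vspace V j. \<phi> j x + \<psi> j x) \<in> rep_hom Q V V"
    if "\<phi> \<in> rep_hom Q V V" "\<psi> \<in> rep_hom Q V V" for \<phi> \<psi>
    apply (rule rep_homI)
    subgoal using R(2) rep_hom_in[OF that(1)] rep_hom_in[OF that(2)] by simp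
    subgoal using that by (simp add: H algebra_simps)
    subgoal using that R rep_hom_in[OF that(1)] rep_hom_in[OF that(2)] by (simp add: H)
    subgoal using that R rep_hom_in[OF that(1)] rep_hom_in[OF that(2)] by (simp add: H)
    using assms by auto
  have mc: "(\<lambda>j\<in>verts Q. compose (vspace V j) (\<phi> j) (\<psi> j)) \<in> rep_hom Q V V"
    if "\<phi> \<in> rep_hom Q V V" "\<psi> \<in> rep_hom Q V V" for \<phi> \<psi>
    unfolding compose_def
    apply (rule rep_homI)
    subgoal using rep_hom_in[OF that(1)] rep_hom_in[OF that(2)] by simp
    subgoal using that rep_hom_in[OF that(2)] by (simp add: H)
    subgoal using that rep_hom_in[OF that(2)] by (simp add: H)
    subgoal using that rep_hom_in[OF that(2)] by (simp add: H)
    using assms by auto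
  have nc: "(\<lambda>j\<in>verts Q. \<lambda>x\<in>vspace V j. scale V (-1) (\<phi> j x)) \<in> rep_hom Q V V"
    if "\<phi> \<in> rep_hom Q V V" for \<phi>
    apply (rule rep_homI)
    subgoal using R(3) rep_hom_in[OF that] by simp
    subgoal using that R rep_hom_in[OF that] by (simp add: H)
    subgoal for j c x using that rep_hom_in[OF that]  R
      by (simp add: H R(6)[symmetric] mult.commute)
    subgoal using that R rep_hom_in[OF that] by (simp add: H)
    using assms by auto
  show ?thesis
  proof (rule ringI)
    show "abelian_group (end_algebra Q V)"
    proof (rule abelian_groupI; simp add: end_algebra_def zc ac)
      fix \<phi> assume p: "\<phi> \<in> rep_hom Q V V"
      show "(\<lambda>j\<in>verts Q. \<lambda>x\<in>vspace V j. (if j \<in> verts Q then \<lambda>x\<in>vspace V j. 0 else undefined) x + \<phi> j x) = \<phi>"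
        by (rule rep_hom_ext[where Q=Q and V=V and W=V]; (rule p)?)
           (use ac[OF zc p] in auto)
      show "\<exists>\<psi>\<in>rep_hom Q V V. (\<lambda>j\<in>verts Q. \<lambda>x\<in>vspace V j. \<psi> j x + \<phi> j x) = (\<lambda>j\<in>verts Q. \<lambda>x\<in>vspace V j. 0)"
        by (rule bexI[OF _ nc[OF p]], intro restrict_ext) (auto simp: neg[symmetric] rep_hom_in[OF p])
    next
      fix a b c assume p: "a \<in> rep_hom Q V V" "b \<in> rep_hom Q V V" "c \<in> rep_hom Q V V"
      show "(\<lambda>j\<in>verts Q. \<lambda>x\<in>vspace V j. (if j \<in> verts Q then \<lambda>x\<in>vspace V j. a j x + b j x else undefined) x + c j x) =
           (\<lambda>j\<in>verts Q. \<lambda>x\<in>vspace V j. a j x + (if j \<in> verts Q then \<lambda>x\<in>vspace V j. b j x + c j x else undefined) x)"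
        by (intro restrict_ext) (simp add: add.assoc)
      show "(\<lambda>j\<in>verts Q. \<lambda>x\<in>vspace V j. a j x + b j x) = (\<lambda>j\<in>verts Q. \<lambda>x\<in>vspace V j. b j x + a j x)"
        by (intro restrict_ext) (simp add: add.commute)
    qed
    show "monoid (end_algebra Q V)"
    proof (rule monoidI; simp add: end_algebra_def oc mc)
      fix a b c assume p: "a \<in> rep_hom Q V V" "b \<in> rep_hom Q V V" "c \<in> rep_hom Q V V"
      show "(\<lambda>j\<in>verts Q. compose (vspace V j) (if j \<in> verts Q then compose (vspace V j) (a j) (b j) else undefined) (c j)) =
       (\<lambda>j\<in>verts Q. compose (vspace V j) (a j) (if j \<in> verts Q then compose (vspace V j) (b j) (c j) else undefined))"
        by (intro restrict_ext) (auto simp: compose_def fun_eq_iff rep_hom_in[OF p(3)])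
    next
      fix a assume p: "a \<in> rep_hom Q V V"
      show "(\<lambda>j\<in>verts Q. compose (vspace V j) (if j \<in> verts Q then \<lambda>x\<in>vspace V j. x else undefined) (a j)) = a"
        by (rule rep_hom_ext[OF mc[OF oc p, simplified] p]) (auto simp: compose_def rep_hom_in[OF p])
      show "(\<lambda>j\<in>verts Q. compose (vspace V j) (a j) (if j \<in> verts Q then \<lambda>x\<in>vspace V j. x else undefined)) = a"
        by (rule rep_hom_ext[OF mc[OF p oc, simplified] p]) (auto simp: compose_def rep_hom_in[OF p])
    qed
    fix a b c assume "a \<in> carrier (end_algebra Q V)" "b \<in> carrier (end_algebra Q V)" "c \<in> carrier (end_algebra Q V)"
    then have p: "a \<in> rep_hom Q V V" "b \<in> rep_hom Q V V" "c \<in> rep_hom Q V V" by (auto simp: end_algebra_def)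
    show "(a \<oplus>\<^bsub>end_algebra Q V\<^esub> b) \<otimes>\<^bsub>end_algebra Q V\<^esub> c =
      a \<otimes>\<^bsub>end_algebra Q V\<^esub> c \<oplus>\<^bsub>end_algebra Q V\<^esub> b \<otimes>\<^bsub>end_algebra Q V\<^esub> c"
      unfolding end_algebra_def by (simp, intro restrict_ext) (auto simp: compose_def fun_eq_iff rep_hom_in[OF p(3)])
    show "c \<otimes>\<^bsub>end_algebra Q V\<^esub> (a \<oplus>\<^bsub>end_algebra Q V\<^esub> b) =
      c \<otimes>\<^bsub>end_algebra Q V\<^esub> a \<oplus>\<^bsub>end_algebra Q V\<^esub> c \<otimes>\<^bsub>end_algebra Q V\<^esub> b"
      unfolding end_algebra_def using p(3) by (simp, intro restrict_ext) (auto simp: compose_def fun_eq_iff rep_hom_in[OF p(1)] rep_hom_in[OF p(2)] H)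
  qed
qed

lemma ring_proj_end: "wf_digraph Q \<Longrightarrow> ring (proj_end K Q d)"
  unfolding proj_end_def by (rule ring_end_algebra[OF is_rep_proj_sum])

end

theory Submission
  imports Defs
begin

text \<open>
  An endomorphism of a sum of projectives is determined by the images of the generators, that is,
  by a matrix whose entries are combinations of paths; composition is matrix multiplication with
  concatenation of paths. Acyclicity makes the matrices without constant paths a nilpotent ideal,
  so they lie in the radical. Conversely, for each generator \<open>s\<close> the matrices whose row \<open>s\<close> has no
  constant paths form a maximal left ideal, so the radical consists exactly of the matrices
  without constant paths. A nonconstant path never ends at the source \<open>v\<close>, so in a product of two
  such matrices the generators at \<open>v\<close> never occur as intermediate index. Therefore the \<open>d v\<close>
  generators at \<open>v\<close> may be traded for \<open>d v\<close> copies of the first arrow of each path leaving \<open>v\<close>.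
\<close>

section \<open>Action of path matrices on coefficient families\<close>

declare split_paired_All [simp del] split_paired_Ex [simp del]

text \<open>The endomorphism with path matrix \<open>m\<close> maps the element \<open>x\<close> of the sum of the projectives
  to \<open>path_act S m x\<close>.\<close>

definition path_act ::
  "'s set \<Rightarrow> ('s \<Rightarrow> 's \<Rightarrow> 'a list \<Rightarrow> 'k::field) \<Rightarrow> ('s \<Rightarrow> 'a list \<Rightarrow> 'k) \<Rightarrow> 's \<Rightarrow> 'a list \<Rightarrow> 'k" where
  "path_act S m x t w = (\<Sum>s\<in>S. \<Sum>n\<le>length w. x s (drop n w) * m s t (take n w))"

text \<open>The basis vector of the path \<open>p\<close> in the summand \<open>s\<close>; for
  \<open>p = []\<close> it is the generator of that summand.\<close>

definition path_vec :: "'s \<Rightarrow> 'a list \<Rightarrow> 's \<Rightarrow> 'a list \<Rightarrow> 'k::field" where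
  "path_vec s p = (\<lambda>t q. if t = s \<and> q = p then 1 else 0)"

lemma path_act_Nil: "path_act S m x t [] = (\<Sum>s\<in>S. x s [] * m s t [])"
  by (simp add: path_act_def)

lemma path_act_add: "path_act S m (x + y) = path_act S m x + path_act S m y"
  by (auto simp: path_act_def fun_eq_iff distrib_right sum.distrib)

lemma path_act_scale: "path_act S m (\<lambda>s p. c * x s p) = (\<lambda>s p. c * path_act S m x s p)"
  by (simp add: path_act_def fun_eq_iff sum_distrib_left mult.assoc)

text \<open>A generator has its only coefficient at the empty path, so only the cut after all of
  \<open>w\<close> survives, and row \<open>s\<close> of the matrix is recovered.\<close>

lemma path_act_path_vec:
  assumes "finite S" "s \<in> S"
  shows "path_act S m (path_vec s []) t w = m s t w"
proof -
  have "(\<Sum>n\<le>length w. path_vec s' [] s' (drop n w) * m s' t (take n w)) = m s' t w" for s'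
  proof -
    have "(\<Sum>n\<le>length w. path_vec s' [] s' (drop n w) * m s' t (take n w))
        = (\<Sum>n\<le>length w. if n = length w then m s' t w else 0)"
      by (rule sum.cong) (auto simp: path_vec_def)
    then show ?thesis by simp
  qed
  moreover have "path_act S m (path_vec s []) t w
      = (\<Sum>s'\<in>S. if s' = s then (\<Sum>n\<le>length w. path_vec s [] s (drop n w) * m s t (take n w)) else 0)"
    unfolding path_act_def by (rule sum.cong) (auto simp: path_vec_def)
  ultimately show ?thesis using assms by simp
qed

text \<open>Matrix entries are prepended to a path while an arrow is appended, so the two operations
  commute. Every cut of \<open>w @ [a]\<close> up to \<open>length w\<close> leaves \<open>a\<close>
  in the second piece; the last cut meets the coefficient of \<open>x'\<close> at the empty path,
  which is zero.\<close>

lemma path_act_snoc: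
  assumes "\<And>s. x' s [] = 0" "\<And>s p. x' s (p @ [a]) = x s p"
  shows "path_act S m x' t (w @ [a]) = path_act S m x t w"
  unfolding path_act_def
proof (rule sum.cong[OF refl])
  fix s
  have "(\<Sum>n\<le>length (w @ [a]). x' s (drop n (w @ [a])) * m s t (take n (w @ [a])))
      = (\<Sum>n\<le>length w. x' s (drop n (w @ [a])) * m s t (take n (w @ [a])))"
    using assms(1) by (simp add: atMost_Suc)
  also have "\<dots> = (\<Sum>n\<le>length w. x s (drop n w) * m s t (take n w))"
    using assms(2) by (intro sum.cong) auto
  finally show "(\<Sum>n\<le>length (w @ [a]). x' s (drop n (w @ [a])) * m s t (take n (w @ [a])))
      = (\<Sum>n\<le>length w. x s (drop n w) * m s t (take n w))" .
qed

text \<open>For \<open>x\<close> the image of a vector under one arrow, this handles the paths that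
  end in a different arrow \<open>a\<close>.\<close>

lemma path_act_snoc_eq_0:
  assumes "\<And>s. x s [] = 0" "\<And>s p. x s (p @ [a]) = 0"
  shows "path_act S m x t (w @ [a]) = 0"
  unfolding path_act_def
proof (intro sum.neutral ballI)
  fix s n
  show "x s (drop n (w @ [a])) * m s t (take n (w @ [a])) = 0"
    using assms by (cases "n \<le> length w") auto
qed

lemma path_act_nonzeroE:
  assumes "path_act S m x t w \<noteq> 0"
  obtains s n where "s \<in> S" "n \<le> length w" "x s (drop n w) \<noteq> 0" "m s t (take n w) \<noteq> 0"
proof -
  obtain s where s: "s \<in> S" "(\<Sum>n\<le>length w. x s (drop n w) * m s t (take n w)) \<noteq> 0"
    using assms unfolding path_act_def by (meson sum.neutral)
  then obtain n where "n \<le> length w" "x s (drop n w) * m s t (take n w) \<noteq> 0"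
    by (metis (no_types, lifting) atMost_iff sum.neutral)
  then show thesis using that s by auto
qed

text \<open>Compares products over different index sets and different arrow types, as needed for a
  quiver and its duplication. Indices in only one of the sets drop out because their matrix entries
  vanish; common indices are compared cut by cut.\<close>

lemma path_act_cong:
  assumes fin: "finite S" "finite S'" and len: "length w' = length w"
    and terms: "\<And>t k. t \<in> S \<Longrightarrow> t \<in> S' \<Longrightarrow> k \<le> length w \<Longrightarrow>
      x' t (drop k w') * m' t u' (take k w') = x t (drop k w) * m t u (take k w)"
    and zero: "\<And>t p. t \<in> S \<Longrightarrow> t \<notin> S' \<Longrightarrow> m t u p = 0" "\<And>t p. t \<in> S' \<Longrightarrow> t \<notin> S \<Longrightarrow> m' t u' p = 0"
  shows "path_act S' m' x' u' w' = path_act S m x u w"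
proof -
  have "path_act S' m' x' u' w' = (\<Sum>t\<in>S \<inter> S'. \<Sum>k\<le>length w. x' t (drop k w') * m' t u' (take k w'))"
    unfolding path_act_def len
  proof (rule sum.mono_neutral_right)
    show "\<forall>t\<in>S' - S \<inter> S'. (\<Sum>k\<le>length w. x' t (drop k w') * m' t u' (take k w')) = 0"
      by (intro ballI sum.neutral) (metis DiffE IntI mult_zero_right zero(2))
  qed (use fin in auto)
  also have "\<dots> = (\<Sum>t\<in>S \<inter> S'. \<Sum>k\<le>length w. x t (drop k w) * m t u (take k w))"
    using terms by (intro sum.cong) auto
  also have "\<dots> = path_act S m x u w"
    unfolding path_act_def
  proof (rule sum.mono_neutral_left)
    show "\<forall>t\<in>S - S \<inter> S'. (\<Sum>k\<le>length w. x t (drop k w) * m t u (take k w)) = 0"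
      by (intro ballI sum.neutral) (metis DiffE IntI mult_zero_right zero(1))
  qed (use fin in auto)
  finally show ?thesis .
qed

subsection \<open>The Jacobson radical\<close>

text \<open>If a maximal left ideal \<open>M\<close> missed an element of \<open>N\<close>, then
  \<open>M + N\<close> would be the whole ring and \<open>1 = a + n\<close> with \<open>a\<close> in
  \<open>M\<close> and \<open>n\<close> in \<open>N\<close>. Each \<open>1 - n^k\<close> is a left
  multiple of \<open>1 - n = a\<close>, so it lies in \<open>M\<close>; once \<open>n^k = 0\<close>,
  this puts \<open>1\<close> into \<open>M\<close>.\<close>

lemma (in ring) nil_left_ideal_subset_jacobson_radical:
  assumes N: "left_ideal N R" and nil: "\<And>x. x \<in> N \<Longrightarrow> \<exists>k::nat. x [^] k = \<zero>"
  shows "N \<subseteq> jacobson_radical R"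
proof
  fix x assume x: "x \<in> N"
  have NR: "N \<subseteq> carrier R" using N by (auto simp: left_ideal_def dest: additive_subgroup.a_subset)
  have "x \<in> M" if "maximal_left_ideal M R" for M
  proof (rule ccontr)
    assume "x \<notin> M"
    have M: "additive_subgroup M R" "\<And>r y. r \<in> carrier R \<Longrightarrow> y \<in> M \<Longrightarrow> r \<otimes> y \<in> M" "M \<noteq> carrier R"
      and max: "\<And>J. left_ideal J R \<Longrightarrow> M \<subseteq> J \<Longrightarrow> J = M \<or> J = carrier R"
      using that by (auto simp: maximal_left_ideal_def left_ideal_def)
    interpret M: additive_subgroup M R by fact
    interpret N: additive_subgroup N R using N by (simp add: left_ideal_def)
    have MR: "M \<subseteq> carrier R" by (rule M.a_subset)
    let ?J = "set_add R M N"
    have J: "additive_subgroup ?J R" by (rule add_additive_subgroups) unfold_locales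
    have "left_ideal ?J R"
      unfolding left_ideal_def
    proof (intro conjI J ballI)
      fix r y assume r: "r \<in> carrier R" and "y \<in> ?J"
      then obtain a b where ab: "a \<in> M" "b \<in> N" "y = a \<oplus> b" by (auto simp: set_add_def')
      then have "r \<otimes> y = r \<otimes> a \<oplus> r \<otimes> b" using r MR NR by (auto simp: r_distr)
      moreover have "r \<otimes> a \<in> M" "r \<otimes> b \<in> N" using ab M N r by (auto simp: left_ideal_def)
      ultimately show "r \<otimes> y \<in> ?J" by (auto simp: set_add_def')
    qed
    moreover have "M \<subseteq> ?J"
    proof
      fix a assume "a \<in> M"
      then have "a = a \<oplus> \<zero>" using MR by auto
      then show "a \<in> ?J" using \<open>a \<in> M\<close> N.zero_closed unfolding set_add_def' by blast
    qed
    moreover have "x \<in> ?J"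
    proof -
      have "x = \<zero> \<oplus> x" using x NR by auto
      then show ?thesis using x M.zero_closed unfolding set_add_def' by blast
    qed
    ultimately have "?J = carrier R" using max \<open>x \<notin> M\<close> by blast
    then have "\<one> \<in> ?J" by simp
    then obtain a n where an: "a \<in> M" "n \<in> N" "\<one> = a \<oplus> n" by (auto simp: set_add_def')
    then have c: "a \<in> carrier R" "n \<in> carrier R" using MR NR by auto
    have a: "\<one> \<ominus> n = a" using an(3) c by (simp add: minus_eq a_assoc r_neg)
    have pow: "\<one> \<ominus> n [^] k \<in> M" for k :: nat
    proof (induction k)
      case 0 then show ?case using M.zero_closed by (simp add: minus_eq r_neg)
    next
      case (Suc k)
      have "\<one> \<ominus> n [^] Suc k = (\<one> \<ominus> n) \<oplus> n \<otimes> (\<one> \<ominus> n [^] k)"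
      proof -
        have "n \<otimes> n [^] k = n [^] Suc k" by (rule nat_pow_Suc2[OF c(2), symmetric])
        then have "n \<otimes> (\<one> \<ominus> n [^] k) = n \<ominus> n [^] Suc k"
          using c by (simp add: minus_eq r_distr r_minus)
        then show ?thesis using c by (simp add: minus_eq a_assoc r_neg1)
      qed
      moreover have "\<dots> \<in> M" using Suc M(2) c an(1) a M.a_closed by auto
      ultimately show ?case by simp
    qed
    obtain k :: nat where "n [^] k = \<zero>" using nil an(2) by blast
    with pow[of k] have "\<one> \<in> M" by (simp add: minus_eq)
    then have "carrier R \<subseteq> M" using M(2)[of _ \<one>] by auto
    then show False using M(3) MR by blast
  qed
  then show "x \<in> jacobson_radical R" using x NR by (auto simp: jacobson_radical_def)
qed

text \<open>Both products of two elements of \<open>I\<close> lie in \<open>I\<close>, where the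
  isomorphism is injective and multiplicative. It therefore preserves and reflects commutation, and
  applying it to both components is a bijection of the pairs.\<close>

lemma ideal_iso_card_commuting_pairs:
  assumes "ideal_iso A I B J"
  shows "card {(x, y). x \<in> I \<and> y \<in> I \<and> x \<otimes>\<^bsub>A\<^esub> y = y \<otimes>\<^bsub>A\<^esub> x}
       = card {(x, y). x \<in> J \<and> y \<in> J \<and> x \<otimes>\<^bsub>B\<^esub> y = y \<otimes>\<^bsub>B\<^esub> x}"
proof -
  obtain \<Psi> where bij: "bij_betw \<Psi> I J" and mult: "\<And>x y. x \<in> I \<Longrightarrow> y \<in> I \<Longrightarrow> \<Psi> (x \<otimes>\<^bsub>A\<^esub> y) = \<Psi> x \<otimes>\<^bsub>B\<^esub> \<Psi> y"
    and I: "ideal I A"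
    using assms by (auto simp: ideal_iso_def)
  have cl: "x \<otimes>\<^bsub>A\<^esub> y \<in> I" if "x \<in> I" "y \<in> I" for x y
    using I that by (meson additive_subgroup.a_subset ideal.I_l_closed ideal_def subsetD)
  have inj: "inj_on \<Psi> I" and im: "\<Psi> ` I = J" using bij by (auto simp: bij_betw_def)
  have comm: "x \<otimes>\<^bsub>A\<^esub> y = y \<otimes>\<^bsub>A\<^esub> x \<longleftrightarrow> \<Psi> x \<otimes>\<^bsub>B\<^esub> \<Psi> y = \<Psi> y \<otimes>\<^bsub>B\<^esub> \<Psi> x" if "x \<in> I" "y \<in> I" for x y
    using inj_on_eq_iff[OF inj cl[OF that] cl[OF that(2,1)]] mult that by auto
  let ?P = "{(x, y). x \<in> I \<and> y \<in> I \<and> x \<otimes>\<^bsub>A\<^esub> y = y \<otimes>\<^bsub>A\<^esub> x}"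
  have "inj_on (map_prod \<Psi> \<Psi>) ?P"
    by (rule inj_on_subset[OF map_prod_inj_on[OF inj inj]]) auto
  moreover have "map_prod \<Psi> \<Psi> ` ?P = {(x, y). x \<in> J \<and> y \<in> J \<and> x \<otimes>\<^bsub>B\<^esub> y = y \<otimes>\<^bsub>B\<^esub> x}" (is "_ = ?R")
  proof (intro equalityI subsetI)
    fix z assume "z \<in> map_prod \<Psi> \<Psi> ` ?P"
    then obtain x y where z: "z = (\<Psi> x, \<Psi> y)" and xy: "x \<in> I" "y \<in> I" "x \<otimes>\<^bsub>A\<^esub> y = y \<otimes>\<^bsub>A\<^esub> x" by auto
    have "\<Psi> x \<otimes>\<^bsub>B\<^esub> \<Psi> y = \<Psi> y \<otimes>\<^bsub>B\<^esub> \<Psi> x" using comm[OF xy(1,2)] xy(3) by blast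
    then show "z \<in> ?R" using im xy(1,2) unfolding z by blast
  next
    fix z assume "z \<in> ?R"
    then obtain x y where "x \<in> I" "y \<in> I" "z = (\<Psi> x, \<Psi> y)" "\<Psi> x \<otimes>\<^bsub>B\<^esub> \<Psi> y = \<Psi> y \<otimes>\<^bsub>B\<^esub> \<Psi> x"
      using im by blast
    then show "z \<in> map_prod \<Psi> \<Psi> ` ?P"
      using comm[of x y] by (intro image_eqI[of _ _ "(x, y)"]) simp_all
  qed
  ultimately show ?thesis using card_image[of "map_prod \<Psi> \<Psi>" ?P] by presburger
qed

subsection \<open>Endomorphisms as matrices of paths\<close>

text \<open>Acyclicity is phrased through closed walks: this form yields the finiteness of the path
  sets and can be checked directly for the duplicated quiver.\<close>

locale acyclic_projectives = fin_digraph Q for Q :: "('v, 'a) pre_digraph" +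
  fixes d :: "'v \<Rightarrow> nat" and K :: "'k::field itself"
  assumes closed_awalk_Nil: "awalk u p u \<Longrightarrow> p = []"
begin

abbreviation V :: "('k, 'v, 'a, 'v \<times> nat \<Rightarrow> 'a list \<Rightarrow> 'k) quiver_rep" where
  "V \<equiv> proj_sum Q d"

abbreviation A where "A \<equiv> proj_end K Q d"

definition S :: "('v \<times> nat) set" where "S = (SIGMA i:verts Q. {1..d i})"

definition matrices :: "('v \<times> nat \<Rightarrow> 'v \<times> nat \<Rightarrow> 'a list \<Rightarrow> 'k) set" where
  "matrices = {m. \<forall>s t p. m s t p \<noteq> 0 \<longrightarrow> s \<in> S \<and> t \<in> S \<and> awalk (fst t) p (fst s)}"

text \<open>The matrix of \<open>\<phi>\<close>: the generator \<open>s\<close> is mapped to the sum of the elements \<open>coef \<phi> s t p\<close>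
  times the path \<open>p\<close> starting at the generator \<open>t\<close>. Hence \<open>p\<close> leads from \<open>fst t\<close> to \<open>fst s\<close>.\<close>

definition coef ::
  "('v \<Rightarrow> ('v \<times> nat \<Rightarrow> 'a list \<Rightarrow> 'k) \<Rightarrow> 'v \<times> nat \<Rightarrow> 'a list \<Rightarrow> 'k) \<Rightarrow>
   'v \<times> nat \<Rightarrow> 'v \<times> nat \<Rightarrow> 'a list \<Rightarrow> 'k" where
  "coef \<phi> s t p = (if s \<in> S then \<phi> (fst s) (path_vec s []) t p else 0)"

text \<open>Restricted to the vertices and their spaces because members of \<open>rep_hom\<close>
  are extensional.\<close>

definition hom_of where
  "hom_of m = (\<lambda>j\<in>verts Q. \<lambda>x\<in>vspace V j. path_act S m x)"

lemma finite_S: "finite S"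
  by (auto simp: S_def)

lemma S_in_verts: "s \<in> S \<Longrightarrow> fst s \<in> verts Q"
  by (auto simp: S_def)

section \<open>Paths in an acyclic quiver\<close>

text \<open>A repeated vertex would split off a nonempty closed walk.\<close>

lemma awalk_imp_apath: "awalk u p w \<Longrightarrow> apath u p w"
  using awalk_not_distinct_decomp[of u p w] closed_awalk_Nil
  by (fastforce simp: apath_def)

lemma finite_awalks: "finite {p. awalk u p w}"
  by (rule finite_subset[OF _ apaths_finite[of u w]]) (auto intro: awalk_imp_apath)

lemma awalk_length: "awalk u p w \<Longrightarrow> length p \<le> card (verts Q)"
  using awalk_imp_apath length_apath by blast

lemma finite_support_if_awalks:
  fixes f :: "'a list \<Rightarrow> 'k"
  assumes "\<And>p. f p \<noteq> 0 \<Longrightarrow> awalk u p w" shows "finite {p. f p \<noteq> 0}"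
  by (rule finite_subset[OF _ finite_awalks[of u w]]) (use assms in auto)

section \<open>Vertex spaces and arrow maps in coordinates\<close>

text \<open>Both finiteness conditions are automatic, since there are finitely many summands and
  finitely many paths between two vertices; only the position of the support remains.\<close>

lemma vspace_iff: "x \<in> vspace V j \<longleftrightarrow> (\<forall>s p. x s p \<noteq> 0 \<longrightarrow> s \<in> S \<and> awalk (fst s) p j)"
proof
  assume xV: "x \<in> vspace V j"
  have x: "x s \<in> free_space {p. awalk (fst s) p j}" if "s \<in> S" for s
    using xV that by (auto simp: proj_sum_def rep_direct_sum_def proj_rep_def S_def)
  have x0: "x s = 0" if "s \<notin> S" for s
    using xV that by (cases s) (auto simp: proj_sum_def rep_direct_sum_def S_def)
  show "\<forall>s p. x s p \<noteq> 0 \<longrightarrow> s \<in> S \<and> awalk (fst s) p j"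
  proof (intro allI impI)
    fix s p assume "x s p \<noteq> 0"
    moreover from this x0 have "s \<in> S" by (metis zero_fun_apply)
    ultimately show "s \<in> S \<and> awalk (fst s) p j" using x[of s] by (auto simp: free_space_def)
  qed
next
  assume *: "\<forall>s p. x s p \<noteq> 0 \<longrightarrow> s \<in> S \<and> awalk (fst s) p j"
  have "{s. x s \<noteq> 0} \<subseteq> S" using * by (auto simp: fun_eq_iff)
  then have "finite {s. x s \<noteq> 0}" using finite_S by (rule finite_subset)
  moreover have "x s \<in> free_space {p. awalk (fst s) p j}" for s
  proof -
    have aw: "x s p \<noteq> 0 \<Longrightarrow> awalk (fst s) p j" for p using * by blast
    then show ?thesis using finite_support_if_awalks[OF aw] unfolding free_space_def by blast
  qed
  moreover have "x s = 0" if "s \<notin> S" for s using * that by (intro ext) (metis zero_fun_apply)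
  ultimately show "x \<in> vspace V j"
    by (auto simp: proj_sum_def rep_direct_sum_def proj_rep_def S_def case_prod_beta)
qed

lemma scale_V: "x \<in> vspace V j \<Longrightarrow> scale V c x = (\<lambda>s p. c * x s p)"
proof (intro ext)
  fix s p assume x: "x \<in> vspace V j"
  have "scale V c x s = (if s \<in> S then (\<lambda>p. c * x s p) else 0)"
    by (auto simp: proj_sum_def rep_direct_sum_def proj_rep_def S_def case_prod_beta)
  moreover have "x s p = 0" if "s \<notin> S" using x that unfolding vspace_iff by blast
  ultimately show "scale V c x s p = c * x s p" by auto
qed

text \<open>Appending an arrow is injective on paths, so the coefficient at
  \<open>w @ [\<beta>]\<close> can only come from \<open>w\<close>.\<close>

lemma arr_map_V:
  assumes "x \<in> vspace V j"
  shows "arr_map V \<alpha> x s [] = 0"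
    and "arr_map V \<alpha> x s (w @ [\<beta>]) = (if \<alpha> = \<beta> then x s w else 0)"
proof -
  have fin: "finite {p. x s p \<noteq> 0}"
    using finite_support_if_awalks[of "x s"] assms unfolding vspace_iff by blast
  have *: "arr_map V \<alpha> x s = (if s \<in> S then lin_extend (\<lambda>p. p @ [\<alpha>]) (x s) else 0)"
    by (auto simp: proj_sum_def rep_direct_sum_def proj_rep_def S_def case_prod_beta)
  show "arr_map V \<alpha> x s [] = 0" by (simp add: * lin_extend_def)
  have "(\<Sum>b | x s b \<noteq> 0. x s b * (if w = b then 1 else 0)) = x s w"
    using fin by (simp add: sum.delta' if_distrib cong: if_cong)
  then have "lin_extend (\<lambda>p. p @ [\<alpha>]) (x s) (w @ [\<beta>]) = (if \<alpha> = \<beta> then x s w else 0)"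
    by (simp add: lin_extend_def)
  moreover have "x s w = 0" if "s \<notin> S" using assms that unfolding vspace_iff by blast
  ultimately show "arr_map V \<alpha> x s (w @ [\<beta>]) = (if \<alpha> = \<beta> then x s w else 0)" by (auto simp: *)
qed

lemma is_rep_V: "is_rep Q V"
  by (rule is_rep_proj_sum) unfold_locales

lemma path_vec_in_vspace:
  "s \<in> S \<Longrightarrow> awalk (fst s) p j \<Longrightarrow> path_vec s p \<in> vspace V j"
  by (auto simp: vspace_iff path_vec_def split: if_splits)

lemma gen_in_vspace: "s \<in> S \<Longrightarrow> path_vec s [] \<in> vspace V (fst s)"
  by (rule path_vec_in_vspace) (auto simp: awalk_Nil_iff S_in_verts)

lemma arr_map_path_vec:
  assumes "s \<in> S" "awalk (fst s) p (tail Q \<alpha>)"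
  shows "arr_map V \<alpha> (path_vec s p) = path_vec s (p @ [\<alpha>])"
proof (intro ext)
  fix t w
  note x = path_vec_in_vspace[OF assms]
  show "arr_map V \<alpha> (path_vec s p) t w = path_vec s (p @ [\<alpha>]) t w"
    by (cases w rule: rev_cases) (auto simp: arr_map_V[OF x], auto simp: path_vec_def)
qed

section \<open>Correspondence between endomorphisms and matrices\<close>

lemma carrier_A: "carrier A = rep_hom Q V V"
  by (simp add: proj_end_def end_algebra_def)

lemma hom_add:
  "\<phi> \<in> carrier A \<Longrightarrow> j \<in> verts Q \<Longrightarrow> x \<in> vspace V j \<Longrightarrow> y \<in> vspace V j \<Longrightarrow> \<phi> j (x + y) = \<phi> j x + \<phi> j y"
  by (simp add: carrier_A rep_hom_def)

lemma hom_scale: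
  "\<phi> \<in> carrier A \<Longrightarrow> j \<in> verts Q \<Longrightarrow> x \<in> vspace V j \<Longrightarrow> \<phi> j (scale V c x) = scale V c (\<phi> j x)"
  by (simp add: carrier_A rep_hom_def)

lemma hom_arr_map:
  "\<phi> \<in> carrier A \<Longrightarrow> \<alpha> \<in> arcs Q \<Longrightarrow> x \<in> vspace V (tail Q \<alpha>) \<Longrightarrow>
    \<phi> (head Q \<alpha>) (arr_map V \<alpha> x) = arr_map V \<alpha> (\<phi> (tail Q \<alpha>) x)"
  by (simp add: carrier_A rep_hom_def)

lemma coef_in_matrices:
  assumes "\<phi> \<in> carrier A" shows "coef \<phi> \<in> matrices"
proof -
  have "\<phi> (fst s) (path_vec s []) \<in> vspace V (fst s)" if "s \<in> S" for s
    using rep_hom_in[of \<phi> Q V V] assms that by (simp add: carrier_A S_in_verts gen_in_vspace)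
  then show ?thesis
    by (auto simp: matrices_def coef_def vspace_iff split: if_splits)
qed

text \<open>Equal coefficients mean equal values on the generators. Compatibility with the arrows
  extends this to all path vectors, and linearity to their finite combinations.\<close>

lemma hom_eqI:
  assumes \<phi>: "\<phi> \<in> carrier A" and \<psi>: "\<psi> \<in> carrier A" and eq: "coef \<phi> = coef \<psi>"
  shows "\<phi> = \<psi>"
proof (rule rep_hom_ext[OF \<phi>[unfolded carrier_A] \<psi>[unfolded carrier_A]])
  fix j x assume j: "j \<in> verts Q" and x: "x \<in> vspace V j"
  have gen: "\<phi> (fst s) (path_vec s []) = \<psi> (fst s) (path_vec s [])" if "s \<in> S" for s
    using fun_cong[OF eq, of s] that by (auto simp: coef_def fun_eq_iff)
  have path: "\<phi> j (path_vec s p) = \<psi> j (path_vec s p)" if "s \<in> S" "awalk (fst s) p j" for s p j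
    using that(2)
  proof (induction p arbitrary: j rule: rev_induct)
    case Nil
    then have "j = fst s" by (simp add: awalk_Nil_iff)
    then show ?case using gen that(1) by simp
  next
    case (snoc \<alpha> p)
    then have \<alpha>: "\<alpha> \<in> arcs Q" "awalk (fst s) p (tail Q \<alpha>)" "j = head Q \<alpha>"
      by (auto simp: awalk_simps)
    show ?case
      using hom_arr_map[OF \<phi> \<alpha>(1) path_vec_in_vspace[OF that(1) \<alpha>(2)]]
        hom_arr_map[OF \<psi> \<alpha>(1) path_vec_in_vspace[OF that(1) \<alpha>(2)]] snoc.IH[OF \<alpha>(2)]
      by (simp add: arr_map_path_vec[OF that(1) \<alpha>(2)] \<alpha>(3))
  qed
  \<comment> \<open>Induction on a finite set \<open>F\<close> containing the support: the component
    of \<open>x\<close> at one path is split off, leaving a vector \<open>y\<close> supported in the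
    smaller set.\<close>
  have "\<phi> j x = \<psi> j x" if "finite F" "x \<in> vspace V j" "{(s, p). x s p \<noteq> 0} \<subseteq> F" for F x
    using that
  proof (induction F arbitrary: x rule: finite_induct)
    case empty
    have "0 \<in> vspace V j" by (simp add: vspace_iff)
    then have "\<phi> j (0 + 0) = \<phi> j 0 + \<phi> j 0" "\<psi> j (0 + 0) = \<psi> j 0 + \<psi> j 0"
      using hom_add \<phi> \<psi> j by blast+
    then have "\<phi> j 0 = 0" "\<psi> j 0 = 0" by simp_all
    moreover have "x = 0" using empty by (auto simp: fun_eq_iff)
    ultimately show ?case by metis
  next
    case (insert b F)
    obtain s p where b: "b = (s, p)" by (cases b)
    show ?case
    proof (cases "x s p = 0")
      case True
      then have "{(s, p). x s p \<noteq> 0} \<subseteq> F" using insert.prems(2) b by auto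
      then show ?thesis using insert.IH insert.prems(1) by blast
    next
      case False
      then have sp: "s \<in> S" "awalk (fst s) p j" using insert.prems(1) by (auto simp: vspace_iff)
      define y where "y = (\<lambda>t q. if t = s \<and> q = p then 0 else x t q)"
      have y: "y \<in> vspace V j" using insert.prems(1) by (auto simp: vspace_iff y_def)
      have "{(s, p). y s p \<noteq> 0} \<subseteq> F" using insert.prems(2) b by (auto simp: y_def split: if_splits)
      then have IH: "\<phi> j y = \<psi> j y" using insert.IH y by blast
      note pv = path_vec_in_vspace[OF sp]
      have "x = y + scale V (x s p) (path_vec s p)"
        unfolding scale_V[OF pv] by (auto simp: y_def path_vec_def fun_eq_iff)
      moreover have "scale V (x s p) (path_vec s p) \<in> vspace V j"
        using is_repD(3)[OF is_rep_V j pv] .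
      ultimately show ?thesis
        using hom_add[OF \<phi> j y] hom_add[OF \<psi> j y] hom_scale[OF \<phi> j pv] hom_scale[OF \<psi> j pv]
          IH path[OF sp] by metis
    qed
  qed
  moreover have "finite {(s, p). x s p \<noteq> 0}"
    by (rule finite_subset[of _ "SIGMA s:S. {p. awalk (fst s) p j}"])
      (use x finite_S finite_awalks in \<open>auto simp: vspace_iff\<close>)
  ultimately show "\<phi> j x = \<psi> j x" using x by blast
qed

text \<open>A nonzero term cuts \<open>w\<close> into a path from \<open>fst t\<close> to
  \<open>fst s\<close> followed by one from \<open>fst s\<close> to \<open>j\<close>.\<close>

lemma path_act_in_vspace:
  assumes "m \<in> matrices" "x \<in> vspace V j"
  shows "path_act S m x \<in> vspace V j"
  unfolding vspace_iff
proof (intro allI impI)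
  fix t w assume "path_act S m x t w \<noteq> 0"
  then obtain s n where "s \<in> S" and 1: "x s (drop n w) \<noteq> 0" and 2: "m s t (take n w) \<noteq> 0"
    by (rule path_act_nonzeroE)
  have "awalk (fst s) (drop n w) j" using assms(2) 1 unfolding vspace_iff by blast
  moreover have "t \<in> S" "awalk (fst t) (take n w) (fst s)"
    using assms(1) 2 unfolding matrices_def by blast+
  ultimately show "t \<in> S \<and> awalk (fst t) w j" by (metis awalk_appendI append_take_drop_id)
qed

lemma hom_of_in_carrier:
  assumes m: "m \<in> matrices" shows "hom_of m \<in> carrier A"
  unfolding hom_of_def carrier_A
proof (rule rep_homI)
  show "path_act S m x \<in> vspace V j" if "x \<in> vspace V j" for x j
    using path_act_in_vspace[OF m that] .
  show "path_act S m (x + y) = path_act S m x + path_act S m y" for x y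
    by (rule path_act_add)
  show "path_act S m (scale V c x) = scale V c (path_act S m x)" if "x \<in> vspace V j" for c x j
    using that path_act_in_vspace[OF m that] by (simp add: scale_V path_act_scale)
  show "path_act S m (arr_map V \<alpha> x) = arr_map V \<alpha> (path_act S m x)"
    if "\<alpha> \<in> arcs Q" and x: "x \<in> vspace V (tail Q \<alpha>)" for \<alpha> x
  proof (intro ext)
    fix t w
    note y = path_act_in_vspace[OF m x]
    show "path_act S m (arr_map V \<alpha> x) t w = arr_map V \<alpha> (path_act S m x) t w"
    \<comment> \<open>The last arrow of \<open>w\<close> decides: if it is \<open>\<alpha>\<close>,
      both sides reduce to the coefficient before appending it; otherwise, and for the empty path,
      both sides vanish.\<close>
    proof (cases w rule: rev_cases)
      case Nil then show ?thesis by (simp add: arr_map_V[OF x] arr_map_V[OF y] path_act_Nil)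
    next
      case (snoc w' \<beta>)
      show ?thesis
      proof (cases "\<alpha> = \<beta>")
        case True
        then show ?thesis using path_act_snoc[of "arr_map V \<alpha> x" \<alpha> x S m t w']
          by (simp add: snoc arr_map_V[OF x] arr_map_V[OF y])
      next
        case False
        then show ?thesis using path_act_snoc_eq_0[of "arr_map V \<alpha> x" \<beta> S m t w']
          by (simp add: snoc arr_map_V[OF x] arr_map_V[OF y])
      qed
    qed
  qed
  show "is_rep Q V" by (rule is_rep_V)
  show "wf_digraph Q" by unfold_locales
qed

lemma coef_hom_of:
  assumes "m \<in> matrices" shows "coef (hom_of m) = m"
proof (intro ext)
  fix s t p
  show "coef (hom_of m) s t p = m s t p"
  proof (cases "s \<in> S")
    case True
    then show ?thesis
      by (simp add: coef_def hom_of_def S_in_verts gen_in_vspace path_act_path_vec finite_S)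
  next
    case False
    then show ?thesis using assms by (auto simp: coef_def matrices_def)
  qed
qed

text \<open>Both sides have the same coefficients by \<open>coef_hom_of\<close>, and
  \<open>coef\<close> is injective on endomorphisms.\<close>

lemma hom_of_coef: "\<phi> \<in> carrier A \<Longrightarrow> hom_of (coef \<phi>) = \<phi>"
  by (meson coef_hom_of coef_in_matrices hom_eqI hom_of_in_carrier)

section \<open>Algebra operations in terms of matrices\<close>

lemma ring_A: "ring A"
  by (rule ring_proj_end) unfold_locales

lemma coef_zero: "coef \<zero>\<^bsub>A\<^esub> s t p = 0"
  by (auto simp: coef_def proj_end_def end_algebra_def S_in_verts gen_in_vspace)

lemma coef_one: "coef \<one>\<^bsub>A\<^esub> s t p = (if s \<in> S \<and> t = s \<and> p = [] then 1 else 0)"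
  using gen_in_vspace[of s]
  by (auto simp: coef_def proj_end_def end_algebra_def S_in_verts path_vec_def)

lemma coef_add: "coef (\<phi> \<oplus>\<^bsub>A\<^esub> \<psi>) s t p = coef \<phi> s t p + coef \<psi> s t p"
  by (auto simp: coef_def proj_end_def end_algebra_def S_in_verts gen_in_vspace)

lemma coef_smult:
  assumes "\<phi> \<in> carrier A"
  shows "coef (c \<odot>\<^bsub>A\<^esub> \<phi>) s t p = c * coef \<phi> s t p"
proof (cases "s \<in> S")
  case True
  then have "\<phi> (fst s) (path_vec s []) \<in> vspace V (fst s)"
    using rep_hom_in[of \<phi> Q V V] assms by (simp add: carrier_A S_in_verts gen_in_vspace)
  then show ?thesis using True
    by (simp add: coef_def proj_end_def end_algebra_def S_in_verts gen_in_vspace scale_V)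
qed (simp add: coef_def)

text \<open>Commutativity of the field lets the scalars \<open>b\<close> and \<open>c\<close> be
  exchanged. Membership in the carrier is what allows scalar multiples to be compared by
  \<open>hom_eqI\<close>.\<close>

lemma smult_closed:
  assumes "\<phi> \<in> carrier A" shows "c \<odot>\<^bsub>A\<^esub> \<phi> \<in> carrier A"
proof -
  note R = is_repD[OF is_rep_V] and in_V = rep_hom_in[OF assms[unfolded carrier_A]]
  have "(\<lambda>j\<in>verts Q. \<lambda>x\<in>vspace V j. scale V c (\<phi> j x)) \<in> rep_hom Q V V"
  proof (rule rep_homI)
    fix j x assume j: "j \<in> verts Q" and x: "x \<in> vspace V j"
    show "scale V c (\<phi> j x) \<in> vspace V j" using R(3)[OF j in_V[OF j x]] .
    show "scale V c (\<phi> j (scale V b x)) = scale V b (scale V c (\<phi> j x))" for b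
      using hom_scale[OF assms j x] R(6)[OF j in_V[OF j x]] by (metis mult.commute)
    show "scale V c (\<phi> j (x + y)) = scale V c (\<phi> j x) + scale V c (\<phi> j y)" if y: "y \<in> vspace V j" for y
      unfolding hom_add[OF assms j x y] by (rule R(4)[OF j in_V[OF j x] in_V[OF j y]])
  next
    fix \<alpha> x assume \<alpha>: "\<alpha> \<in> arcs Q" and x: "x \<in> vspace V (tail Q \<alpha>)"
    show "scale V c (\<phi> (head Q \<alpha>) (arr_map V \<alpha> x)) = arr_map V \<alpha> (scale V c (\<phi> (tail Q \<alpha>) x))"
      unfolding hom_arr_map[OF assms \<alpha> x]
      by (rule R(10)[OF \<alpha> in_V[OF tail_in_verts[OF \<alpha>] x], symmetric])
  qed (rule is_rep_V, unfold_locales)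
  then show ?thesis unfolding carrier_A by (simp add: proj_end_def end_algebra_def)
qed

text \<open>First \<open>\<psi>\<close> sends the generator \<open>s\<close> to the vector
  \<open>coef \<psi> s\<close>; then \<open>\<phi>\<close> acts on that vector through its
  matrix.\<close>

lemma coef_mult:
  assumes "\<phi> \<in> carrier A" "\<psi> \<in> carrier A"
  shows "coef (\<phi> \<otimes>\<^bsub>A\<^esub> \<psi>) s = path_act S (coef \<phi>) (coef \<psi> s)"
proof (cases "s \<in> S")
  case True
  let ?y = "\<psi> (fst s) (path_vec s [])"
  have y: "?y \<in> vspace V (fst s)"
    using rep_hom_in[of \<psi> Q V V] assms True by (simp add: carrier_A S_in_verts gen_in_vspace)
  have "coef (\<phi> \<otimes>\<^bsub>A\<^esub> \<psi>) s = \<phi> (fst s) ?y"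
    using True
    by (intro ext) (simp add: coef_def proj_end_def end_algebra_def S_in_verts gen_in_vspace compose_def)
  also have "\<dots> = hom_of (coef \<phi>) (fst s) ?y" by (simp add: hom_of_coef assms)
  also have "\<dots> = path_act S (coef \<phi>) ?y" using y True by (simp add: hom_of_def S_in_verts)
  also have "?y = coef \<psi> s" using True by (intro ext) (simp add: coef_def)
  finally show ?thesis .
next
  case False
  then show ?thesis by (auto simp: coef_def path_act_def fun_eq_iff)
qed

lemma coef_a_inv:
  assumes "\<phi> \<in> carrier A" shows "coef (\<ominus>\<^bsub>A\<^esub> \<phi>) s t p = - coef \<phi> s t p"
proof -
  interpret A: ring A by (rule ring_A)
  have "coef (\<phi> \<oplus>\<^bsub>A\<^esub> \<ominus>\<^bsub>A\<^esub> \<phi>) s t p = 0" using assms by (simp add: A.r_neg coef_zero)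
  then show ?thesis by (simp add: coef_add eq_neg_iff_add_eq_0 add.commute)
qed

text \<open>The predicate \<open>P\<close> selects rows: all of them for \<open>rad_ideal\<close>, a
  single one for a maximal left ideal.\<close>

lemma additive_subgroup_coef_eq_0:
  "additive_subgroup {\<phi> \<in> carrier A. \<forall>s t. P s \<longrightarrow> coef \<phi> s t [] = 0} A"
proof (rule additive_subgroupI)
  interpret A: ring A by (rule ring_A)
  show "subgroup {\<phi> \<in> carrier A. \<forall>s t. P s \<longrightarrow> coef \<phi> s t [] = 0} (add_monoid A)"
    by (rule A.add.subgroupI)
      (auto simp: coef_zero coef_add coef_a_inv a_inv_def[symmetric] intro!: exI[of _ "\<zero>\<^bsub>A\<^esub>"])
qed

section \<open>The radical as the ideal without constant paths\<close>

definition rad_ideal where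
  "rad_ideal = {\<phi> \<in> carrier A. \<forall>s t. coef \<phi> s t [] = 0}"

text \<open>The empty path factors only into empty paths, so every summand of a constant coefficient
  of the product contains a constant coefficient of \<open>a\<close>.\<close>

lemma ideal_rad_ideal: "ideal rad_ideal A"
proof (rule idealI[OF ring_A])
  interpret A: ring A by (rule ring_A)
  show "subgroup rad_ideal (add_monoid A)"
    using additive_subgroup_coef_eq_0[of "\<lambda>_. True"] by (simp add: rad_ideal_def additive_subgroup_def)
  fix a x assume "a \<in> rad_ideal" "x \<in> carrier A"
  then show "x \<otimes>\<^bsub>A\<^esub> a \<in> rad_ideal" "a \<otimes>\<^bsub>A\<^esub> x \<in> rad_ideal"
    by (auto simp: rad_ideal_def coef_mult path_act_Nil)
qed

text \<open>Each factor contributes at least one arrow, so the \<open>n\<close>-th power has no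
  coefficients at paths shorter than \<open>n\<close>. Paths have at most
  \<open>card (verts Q)\<close> arrows, so nothing is left at the next exponent.\<close>

lemma rad_ideal_nilpotent:
  assumes "\<phi> \<in> rad_ideal"
  shows "\<phi> [^]\<^bsub>A\<^esub> Suc (card (verts Q)) = \<zero>\<^bsub>A\<^esub>"
proof -
  interpret A: ring A by (rule ring_A)
  have \<phi>: "\<phi> \<in> carrier A" "coef \<phi> s t [] = 0" for s t using assms by (auto simp: rad_ideal_def)
  have "coef (\<phi> [^]\<^bsub>A\<^esub> n) s t w = 0" if "length w < n" for n s t w
    using that
  proof (induction n arbitrary: s t w)
    case (Suc n)
    have "path_act S (coef (\<phi> [^]\<^bsub>A\<^esub> n)) (coef \<phi> s) t w = 0"
    proof (rule ccontr)
      assume "path_act S (coef (\<phi> [^]\<^bsub>A\<^esub> n)) (coef \<phi> s) t w \<noteq> 0"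
      then obtain s' k where "k \<le> length w" "coef \<phi> s s' (drop k w) \<noteq> 0" and
        nz: "coef (\<phi> [^]\<^bsub>A\<^esub> n) s' t (take k w) \<noteq> 0"
        by (rule path_act_nonzeroE)
      \<comment> \<open>For \<open>k = length w\<close> the factor \<open>\<phi>\<close> would
        contribute a constant path.\<close>
      then have "k < length w" using \<phi>(2) by (metis drop_all linorder_not_le)
      then show False using Suc.IH[of "take k w"] Suc.prems nz by simp
    qed
    then show ?case by (simp add: coef_mult \<phi>)
  qed simp
  moreover have "coef (\<phi> [^]\<^bsub>A\<^esub> n) s t w = 0" if "card (verts Q) < length w" for n :: nat and s t w
    using coef_in_matrices[OF A.nat_pow_closed[OF \<phi>(1)]] awalk_length that
    unfolding matrices_def by (metis (mono_tags, lifting) linorder_not_le mem_Collect_eq)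
  ultimately have "coef (\<phi> [^]\<^bsub>A\<^esub> Suc (card (verts Q))) s t w = coef \<zero>\<^bsub>A\<^esub> s t w" for s t w
    unfolding coef_zero by (metis le_imp_less_Suc linorder_not_le)
  then show ?thesis using \<phi>(1) by (intro hom_eqI ext) auto
qed

text \<open>Suppose a larger left ideal contains \<open>\<psi>\<close> with a nonzero constant
  coefficient in row \<open>s\<close>. A scaled matrix unit on the left turns the constant part of
  that row into that of the identity, so the identity differs from an element of \<open>J\<close> by
  an element of \<open>I\<close>, and \<open>J\<close> is everything.\<close>

lemma maximal_left_ideal_coef:
  assumes "s \<in> S"
  shows "maximal_left_ideal {\<phi> \<in> carrier A. \<forall>t. coef \<phi> s t [] = 0} A"
proof -
  interpret A: ring A by (rule ring_A)
  define I where "I = {\<phi> \<in> carrier A. \<forall>t. coef \<phi> s t [] = 0}"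
  have mem_I: "\<phi> \<in> I \<longleftrightarrow> \<phi> \<in> carrier A \<and> (\<forall>t. coef \<phi> s t [] = 0)" for \<phi> by (simp add: I_def)
  have "additive_subgroup I A" using additive_subgroup_coef_eq_0[of "\<lambda>s'. s' = s"] by (simp add: I_def)
  then have left: "left_ideal I A"
    by (auto simp: left_ideal_def coef_mult path_act_Nil mem_I)
  have "\<one>\<^bsub>A\<^esub> \<notin> I" using assms by (auto simp: coef_one mem_I)
  then have ne: "I \<noteq> carrier A" by blast
  have "J = I \<or> J = carrier A" if J: "left_ideal J A" and sub: "I \<subseteq> J" for J
  proof (rule disjCI)
    interpret J: additive_subgroup J A using J by (simp add: left_ideal_def)
    assume "J \<noteq> carrier A"
    moreover have "J = carrier A" if JI: "J \<noteq> I"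
    proof -
      obtain \<psi> where \<psi>: "\<psi> \<in> J" "\<psi> \<notin> I" using JI sub by blast
      have \<psi>A: "\<psi> \<in> carrier A" using \<psi> J.a_subset by blast
      then obtain t where t: "coef \<psi> s t [] \<noteq> 0" using \<psi> mem_I by blast
      \<comment> \<open>A constant path joins two generators only over the same vertex, which makes
        the matrix unit \<open>m\<close> between \<open>t\<close> and \<open>s\<close>
        admissible.\<close>
      then have tS: "t \<in> S" "fst t = fst s"
        using coef_in_matrices[OF \<psi>A] unfolding matrices_def mem_Collect_eq
        by (metis awalk_Nil_iff)+
      define m :: "'v \<times> nat \<Rightarrow> 'v \<times> nat \<Rightarrow> 'a list \<Rightarrow> 'k" where
        "m = (\<lambda>t' u p. if t' = t \<and> u = s \<and> p = [] then 1 / coef \<psi> s t [] else 0)"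
      have m: "m \<in> matrices" using tS assms by (auto simp: matrices_def m_def awalk_Nil_iff S_in_verts)
      define \<chi> where "\<chi> = hom_of m \<otimes>\<^bsub>A\<^esub> \<psi>"
      have \<chi>: "\<chi> \<in> J" using J \<psi>(1) hom_of_in_carrier[OF m] by (simp add: \<chi>_def left_ideal_def)
      have \<chi>A: "\<chi> \<in> carrier A" using \<chi> J.a_subset by blast
      have "coef \<chi> s u [] = (if u = s then 1 else 0)" for u
      proof -
        have "coef \<chi> s u [] = (\<Sum>t'\<in>S. coef \<psi> s t' [] * m t' u [])"
          by (simp add: \<chi>_def coef_mult \<psi>A hom_of_in_carrier[OF m] coef_hom_of[OF m] path_act_Nil)
        also have "\<dots> = (\<Sum>t'\<in>S. if t' = t then coef \<psi> s t [] * m t u [] else 0)"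
          by (rule sum.cong) (auto simp: m_def)
        also have "\<dots> = coef \<psi> s t [] * m t u []" using tS finite_S by simp
        finally show ?thesis using t by (simp add: m_def)
      qed
      then have "\<one>\<^bsub>A\<^esub> \<ominus>\<^bsub>A\<^esub> \<chi> \<in> I"
        using \<chi>A assms by (auto simp: A.minus_eq coef_add coef_a_inv coef_one mem_I)
      then have "\<one>\<^bsub>A\<^esub> \<ominus>\<^bsub>A\<^esub> \<chi> \<in> J" using sub by blast
      then have "(\<one>\<^bsub>A\<^esub> \<ominus>\<^bsub>A\<^esub> \<chi>) \<oplus>\<^bsub>A\<^esub> \<chi> \<in> J" using \<chi> by (rule J.a_closed)
      then have "\<one>\<^bsub>A\<^esub> \<in> J" using \<chi>A by (simp add: A.minus_eq A.a_assoc A.l_neg)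
      then have "r \<in> J" if "r \<in> carrier A" for r
        using J that unfolding left_ideal_def by (metis A.r_one)
      then show ?thesis using J.a_subset by blast
    qed
    ultimately show "J = I" by blast
  qed
  then show ?thesis using left ne unfolding maximal_left_ideal_def I_def[symmetric] by blast
qed

text \<open>The maximal left ideals of the single rows intersect in \<open>rad_ideal\<close>, which
  bounds the radical from above; nilpotency gives the other inclusion. Rows outside \<open>S\<close>
  are zero by the default in \<open>coef\<close>.\<close>

lemma jacobson_radical_A: "jacobson_radical A = rad_ideal"
proof
  show "jacobson_radical A \<subseteq> rad_ideal"
  proof
    fix x assume x: "x \<in> jacobson_radical A"
    have "coef x s t [] = 0" for s t
    proof (cases "s \<in> S")
      case True
      then have "x \<in> {\<phi> \<in> carrier A. \<forall>t. coef \<phi> s t [] = 0}"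
        using x maximal_left_ideal_coef[OF True] unfolding jacobson_radical_def by blast
      then show ?thesis by simp
    qed (simp add: coef_def)
    then show "x \<in> rad_ideal" using x by (simp add: rad_ideal_def jacobson_radical_def)
  qed
  have "left_ideal rad_ideal A"
    using ideal_rad_ideal by (auto simp: left_ideal_def ideal_def ideal_axioms_def)
  then show "rad_ideal \<subseteq> jacobson_radical A"
    using ring.nil_left_ideal_subset_jacobson_radical[OF ring_A] rad_ideal_nilpotent by blast
qed

section \<open>Matrices of radical elements\<close>

definition nonconstant :: "'v \<times> nat \<Rightarrow> 'v \<times> nat \<Rightarrow> 'a list \<Rightarrow> bool" where
  "nonconstant s t p \<longleftrightarrow> p \<noteq> [] \<and> s \<in> S \<and> t \<in> S \<and> awalk (fst t) p (fst s)"

definition rad_matrices :: "('v \<times> nat \<Rightarrow> 'v \<times> nat \<Rightarrow> 'a list \<Rightarrow> 'k) set" where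
  "rad_matrices = {m. \<forall>s t p. m s t p \<noteq> 0 \<longrightarrow> nonconstant s t p}"

lemma rad_matricesD: "m \<in> rad_matrices \<Longrightarrow> \<not> nonconstant s t p \<Longrightarrow> m s t p = 0"
  by (auto simp: rad_matrices_def)

lemma rad_matrices_subset: "m \<in> rad_matrices \<Longrightarrow> m \<in> matrices"
  by (auto simp: rad_matrices_def matrices_def nonconstant_def)

lemma coef_in_rad_matrices:
  assumes "\<phi> \<in> rad_ideal" shows "coef \<phi> \<in> rad_matrices"
  using assms coef_in_matrices[of \<phi>]
  by (auto simp: rad_ideal_def rad_matrices_def matrices_def nonconstant_def)

lemma hom_of_in_rad_ideal: "m \<in> rad_matrices \<Longrightarrow> hom_of m \<in> rad_ideal"
  using rad_matricesD[of m]
  by (simp add: rad_ideal_def rad_matrices_subset hom_of_in_carrier coef_hom_of)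
    (auto simp: nonconstant_def)

end

subsection \<open>Duplicating the arrows at a source\<close>

declare One_nat_def [simp del]

locale source_duplication = acyclic_projectives Q d K
  for Q :: "('v, 'a) pre_digraph" and d and K :: "'k::field itself" +
  fixes v :: 'v
  assumes source_v: "source_vertex Q v"
begin

abbreviation D where "D \<equiv> dup_quiver Q v (d v)"

lemma head_ne_v: "\<alpha> \<in> arcs Q \<Longrightarrow> head Q \<alpha> \<noteq> v"
  using source_v by (auto simp: source_vertex_def)

lemma arcs_dup [simp]:
  "Inl \<alpha> \<in> arcs D \<longleftrightarrow> \<alpha> \<in> arcs Q \<and> tail Q \<alpha> \<noteq> v"
  "Inr (\<alpha>, k) \<in> arcs D \<longleftrightarrow> \<alpha> \<in> arcs Q \<and> tail Q \<alpha> = v \<and> k \<in> {1..d v}"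
  by (auto simp: dup_quiver_def)

lemma dup_simps [simp]:
  "verts D = verts Q" "tail D (Inl \<alpha>) = tail Q \<alpha>" "head D (Inl \<alpha>) = head Q \<alpha>"
  "tail D (Inr (\<alpha>, k)) = tail Q \<alpha>" "head D (Inr (\<alpha>, k)) = head Q \<alpha>"
  by (simp_all add: dup_quiver_def)

lemma fin_digraph_dup: "fin_digraph D"
proof unfold_locales
  fix e assume e: "e \<in> arcs D"
  then show "tail D e \<in> verts D" "head D e \<in> verts D" by (cases e; auto)+
qed (auto simp: dup_quiver_def out_arcs_def)

interpretation dup: fin_digraph D by (rule fin_digraph_dup)

section \<open>Paths in the duplicated quiver\<close>

text \<open>No arrow ends at \<open>v\<close>, so a walk starting elsewhere never visits
  \<open>v\<close> and uses only kept arrows.\<close>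

lemma awalk_dup:
  "i \<noteq> v \<Longrightarrow> dup.awalk i r j \<longleftrightarrow> (\<exists>p. r = map Inl p \<and> awalk i p j)"
proof (induction r arbitrary: i)
  case Nil
  then show ?case by (auto simp: awalk_Nil_iff dup.awalk_Nil_iff)
next
  case (Cons e r)
  show ?case
  proof (cases e)
    case (Inl \<alpha>)
    have "dup.awalk i (e # r) j \<longleftrightarrow>
        \<alpha> \<in> arcs Q \<and> i = tail Q \<alpha> \<and> (\<exists>p. r = map Inl p \<and> awalk (head Q \<alpha>) p j)"
      using Cons Inl head_ne_v by (auto simp: dup.awalk_Cons_iff)
    also have "\<dots> \<longleftrightarrow> (\<exists>p. e # r = map Inl p \<and> awalk i p j)"
      using Inl by (auto simp: Cons_eq_map_conv awalk_Cons_iff)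
    finally show ?thesis .
  next
    case (Inr b)
    then show ?thesis using Cons.prems by (cases b) (auto simp: dup.awalk_Cons_iff)
  qed
qed

text \<open>The first arrow leaves \<open>v\<close> and is therefore a copy; its head differs from
  \<open>v\<close>, so \<open>awalk_dup\<close> describes the rest.\<close>

lemma awalk_dup_source:
  assumes "r \<noteq> []"
  shows "dup.awalk v r j \<longleftrightarrow>
    (\<exists>\<alpha> k p. r = Inr (\<alpha>, k) # map Inl p \<and> k \<in> {1..d v} \<and> awalk v (\<alpha> # p) j)"
proof -
  obtain e q where r: "r = e # q" using assms by (cases r) auto
  show ?thesis
  proof (cases e)
    case (Inl \<alpha>)
    then show ?thesis by (auto simp: r dup.awalk_Cons_iff)
  next
    case (Inr b)
    then obtain \<alpha> k where e: "e = Inr (\<alpha>, k)" by (cases b) auto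
    have "dup.awalk (head Q \<alpha>) q j \<longleftrightarrow> (\<exists>p. q = map Inl p \<and> awalk (head Q \<alpha>) p j)" if "\<alpha> \<in> arcs Q"
      using awalk_dup[OF head_ne_v[OF that]] .
    then show ?thesis by (auto simp: r e dup.awalk_Cons_iff awalk_Cons_iff)
  qed
qed

lemma awalk_to_v: "awalk i p v \<Longrightarrow> p = []"
  using head_ne_v by (cases p rule: rev_cases) (auto simp: awalk_simps)

end

text \<open>A nonempty closed walk at \<open>v\<close> would give a nonempty walk of
  \<open>Q\<close> ending at \<open>v\<close>; at any other vertex a closed walk is already one of
  \<open>Q\<close>. This transfers the matrix description and the radical to the duplicated
  quiver.\<close>

sublocale source_duplication \<subseteq> dup: acyclic_projectives "dup_quiver Q v (d v)" "d(v := 1)" K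
proof -
  interpret dup: fin_digraph D by (rule fin_digraph_dup)
  show "acyclic_projectives D"
  proof
    fix u p assume p: "dup.awalk u p u"
    show "p = []"
    proof (cases "u = v")
      case True
      then show ?thesis using p awalk_dup_source[of p v] awalk_to_v by blast
    next
      case False
      then show ?thesis using p awalk_dup[of u p u] closed_awalk_Nil by auto
    qed
  qed
qed

context source_duplication
begin

section \<open>Generators, positions and matrices under duplication\<close>

lemma in_S_dup: "fst s \<noteq> v \<Longrightarrow> s \<in> dup.S \<longleftrightarrow> s \<in> S"
  by (cases s) (auto simp: S_def dup.S_def)

lemma in_S_v: "(v, k) \<in> S \<longleftrightarrow> k \<in> {1..d v}" "(v, k) \<in> dup.S \<longleftrightarrow> k = 1"
  using source_v by (auto simp: S_def dup.S_def source_vertex_def)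

text \<open>In a product of radical matrices an intermediate generator is the end of a nonconstant
  path, so by this lemma it never lies over \<open>v\<close>.\<close>

lemma nonconstant_not_v:
  assumes "nonconstant s t p" shows "fst s \<noteq> v"
  using assms awalk_to_v by (auto simp: nonconstant_def)

lemma nonconstant_dup:
  assumes "fst t \<noteq> v"
  shows "dup.nonconstant s t r \<longleftrightarrow> (\<exists>p. r = map Inl p \<and> nonconstant s t p)"
  using awalk_dup[OF assms] in_S_dup[OF assms] in_S_dup[of s] awalk_to_v[of "fst t"]
  by (auto simp: nonconstant_def dup.nonconstant_def)

lemma nonconstant_dup_source:
  "dup.nonconstant s (v, k') r \<longleftrightarrow>
    k' = 1 \<and> (\<exists>\<alpha> k p. r = Inr (\<alpha>, k) # map Inl p \<and> nonconstant s (v, k) (\<alpha> # p))"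
proof -
  have "dup.nonconstant s (v, k') r \<longleftrightarrow>
      k' = 1 \<and> s \<in> dup.S \<and> (\<exists>\<alpha> k p. r = Inr (\<alpha>, k) # map Inl p \<and> k \<in> {1..d v} \<and> awalk v (\<alpha> # p) (fst s))"
    using awalk_dup_source[of r "fst s"] by (auto simp: dup.nonconstant_def in_S_v)
  moreover have "s \<in> dup.S \<longleftrightarrow> s \<in> S" if "awalk v (\<alpha> # p) (fst s)" for \<alpha> p
    using that awalk_to_v in_S_dup by (cases "fst s = v") auto
  ultimately show ?thesis by (auto simp: nonconstant_def in_S_v)
qed

lemma dup_nonconstant_not_v: "dup.nonconstant s t r \<Longrightarrow> fst s \<noteq> v"
  by (metis nonconstant_dup nonconstant_dup_source nonconstant_not_v prod.collapse)

text \<open>An arrow copy \<open>Inr (\<alpha>, k)\<close> leaving the single generator at \<open>v\<close> stands for \<open>\<alpha>\<close>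
  leaving the \<open>k\<close>-th generator at \<open>v\<close>.\<close>

definition dup_matrix where
  "dup_matrix m s t r =
     (if dup.nonconstant s t r
      then m s (case r of Inr (\<alpha>, k) # _ \<Rightarrow> (v, k) | _ \<Rightarrow> t) (map (case_sum id fst) r)
      else (0::'k))"

lemma case_sum_Inl: "map (case_sum id fst) (map Inl p) = p"
  by (induction p) auto

text \<open>As \<open>map Inl\<close> is injective, the guard in \<open>dup_matrix\<close> holds
  exactly at the nonconstant positions of \<open>Q\<close>; elsewhere \<open>m\<close> is zero
  too.\<close>

lemma dup_matrix_Inl:
  assumes "m \<in> rad_matrices" "fst t \<noteq> v"
  shows "dup_matrix m s t (map Inl p) = m s t p"
proof -
  have "inj (map (Inl :: 'a \<Rightarrow> 'a + 'a \<times> nat))" by simp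
  then have "dup.nonconstant s t (map Inl p) \<longleftrightarrow> nonconstant s t p"
    by (auto simp: nonconstant_dup[OF assms(2)] inj_eq)
  then show ?thesis using rad_matricesD[OF assms(1)]
    by (cases p) (auto simp: dup_matrix_def simp del: map_map simp: case_sum_Inl)
qed

lemma dup_matrix_Inr:
  assumes "m \<in> rad_matrices"
  shows "dup_matrix m s (v, 1) (Inr (\<alpha>, k) # map Inl p) = m s (v, k) (\<alpha> # p)"
proof -
  have "inj (map (Inl :: 'a \<Rightarrow> 'a + 'a \<times> nat))" by simp
  then have "dup.nonconstant s (v, 1) (Inr (\<alpha>, k) # map Inl p) \<longleftrightarrow> nonconstant s (v, k) (\<alpha> # p)"
    by (auto simp: nonconstant_dup_source inj_eq)
  then show ?thesis using rad_matricesD[OF assms]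
    by (auto simp: dup_matrix_def simp del: map_map simp: case_sum_Inl)
qed

lemma dup_matrix_in_rad_matrices: "dup_matrix m \<in> dup.rad_matrices"
  by (auto simp: dup_matrix_def dup.rad_matrices_def)

lemma dup_nonconstantE:
  assumes "dup.nonconstant s t r"
  obtains p where "fst t \<noteq> v" "r = map Inl p"
    | \<alpha> k p where "t = (v, 1)" "r = Inr (\<alpha>, k) # map Inl p"
  using assms nonconstant_dup[of t s r] nonconstant_dup_source[of s "snd t" r]
  by (cases "fst t = v"; cases t) auto

text \<open>Every nonconstant entry of \<open>m\<close> reappears in \<open>dup_matrix m\<close>: at
  the same path, or with its first arrow replaced by a copy if it starts over
  \<open>v\<close>.\<close>

lemma dup_matrix_inj:
  assumes "m \<in> rad_matrices" "n \<in> rad_matrices" "dup_matrix m = dup_matrix n"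
  shows "m = n"
proof (intro ext)
  fix s t p
  show "m s t p = n s t p"
  proof (cases "nonconstant s t p")
    case True
    show ?thesis
    proof (cases "fst t = v")
      case True
      obtain \<alpha> q where "p = \<alpha> # q" using \<open>nonconstant s t p\<close> by (cases p) (auto simp: nonconstant_def)
      moreover have "t = (v, snd t)" using True by (cases t) auto
      ultimately show ?thesis using assms dup_matrix_Inr by metis
    next
      case False
      then show ?thesis using assms dup_matrix_Inl by metis
    qed
  next
    case False
    then show ?thesis using assms(1,2) by (simp add: rad_matricesD)
  qed
qed

lemma dup_matrix_surj:
  assumes "m' \<in> dup.rad_matrices"
  obtains m where "m \<in> rad_matrices" "dup_matrix m = m'"
proof
  \<comment> \<open>The inverse assignment: the number \<open>snd t\<close> of the generator over
    \<open>v\<close> becomes the copy number of the first arrow. Nonconstancy ensures that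
    \<open>hd p\<close> exists.\<close>
  let ?m = "\<lambda>s t p. if nonconstant s t p
    then if fst t = v then m' s (v, 1) (Inr (hd p, snd t) # map Inl (tl p)) else m' s t (map Inl p)
    else 0"
  show m: "?m \<in> rad_matrices" by (simp add: rad_matrices_def)
  show "dup_matrix ?m = m'"
  proof (intro ext)
    fix s t r
    show "dup_matrix ?m s t r = m' s t r"
    proof (cases "dup.nonconstant s t r")
      case True
      then show ?thesis
      proof (cases rule: dup_nonconstantE)
        case (1 p)
        then have "nonconstant s t p" using True nonconstant_dup[OF 1(1), of s r] by (auto dest: map_injective[OF _ inj_Inl])
        then show ?thesis using 1 dup_matrix_Inl[OF m 1(1)] by simp
      next
        case (2 \<alpha> k p)
        then have "nonconstant s (v, k) (\<alpha> # p)"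
          using True nonconstant_dup_source[of s 1 r] by (auto dest: map_injective[OF _ inj_Inl])
        then show ?thesis using 2 dup_matrix_Inr[OF m] by simp
      qed
    next
      case False
      then show ?thesis using assms by (simp add: dup_matrix_def dup.rad_matricesD)
    qed
  qed
qed

text \<open>Forgetting copy numbers preserves length, so cuts of \<open>r\<close> correspond to cuts
  of its image. In a contributing term the first piece is nonempty and carries the copied arrow, if
  any, while the second piece consists of kept arrows.\<close>

lemma dup_matrix_mult:
  assumes m: "m \<in> rad_matrices" and n: "n \<in> rad_matrices" and ur: "dup.nonconstant s u r"
  shows "path_act dup.S (dup_matrix m) (dup_matrix n s) u r = dup_matrix (\<lambda>s. path_act S m (n s)) s u r"
proof -
  let ?u = "case r of Inr (\<alpha>, k) # _ \<Rightarrow> (v, k) | _ \<Rightarrow> u" and ?w = "map (case_sum id fst) r"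
  have "path_act dup.S (dup_matrix m) (dup_matrix n s) u r = path_act S m (n s) ?u ?w"
  proof (rule path_act_cong)
    fix t k assume t: "t \<in> S" "t \<in> dup.S" and k: "k \<le> length ?w"
    show "dup_matrix n s t (drop k r) * dup_matrix m t u (take k r) = n s t (drop k ?w) * m t ?u (take k ?w)"
    \<comment> \<open>Here the first piece would end at \<open>v\<close> or be constant, so the
      entries of both matrices vanish.\<close>
    proof (cases "fst t = v \<or> k = 0")
      case True
      then have "\<not> nonconstant t ?u (take k ?w)"
        using nonconstant_not_v[of t ?u "take k ?w"] by (metis nonconstant_def take_0)
      moreover have "\<not> dup.nonconstant t u (take k r)"
        using True dup_nonconstant_not_v[of t u "take k r"] by (metis dup.nonconstant_def take_0)
      ultimately show ?thesis
        using rad_matricesD[OF m] dup.rad_matricesD[OF dup_matrix_in_rad_matrices] by simp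
    next
      case False
      then obtain k' where k': "k = Suc k'" and tv: "fst t \<noteq> v" by (cases k) auto
      from ur show ?thesis
      proof (cases rule: dup_nonconstantE)
        case (1 p)
        then have "?u = u" "?w = p" by (cases p; simp add: case_sum_Inl del: map_map)+
        then show ?thesis
          using 1 dup_matrix_Inl[OF m 1(1)] dup_matrix_Inl[OF n tv] by (simp add: drop_map take_map)
      next
        case (2 \<alpha> l p)
        then have "?u = (v, l)" "?w = \<alpha> # p" by (simp_all add: case_sum_Inl del: map_map)
        then show ?thesis
          using 2 k' dup_matrix_Inr[OF m] dup_matrix_Inl[OF n tv] by (simp add: drop_map take_map)
      qed
    qed
  next
    \<comment> \<open>Only generators over \<open>v\<close> are lost, and their rows are
      zero.\<close>
    fix t p assume t: "t \<in> S" "t \<notin> dup.S"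
    then show "m t ?u p = 0" using in_S_dup nonconstant_not_v rad_matricesD[OF m] by metis
  next
    \<comment> \<open>This occurs only for \<open>t = (v, 1)\<close> with \<open>d v = 0\<close>; a
      nonconstant position in row \<open>t\<close> would put \<open>t\<close> into
      \<open>S\<close>.\<close>
    fix t p assume t: "t \<in> dup.S" "t \<notin> S"
    then have "\<not> dup.nonconstant t u p"
      using nonconstant_dup[of u t p] nonconstant_dup_source[of t "snd u" p]
      by (cases u; cases "fst u = v") (auto simp: nonconstant_def)
    then show "dup_matrix m t u p = 0" by (simp add: dup_matrix_def)
  qed (use finite_S dup.finite_S in auto)
  then show ?thesis using ur by (simp add: dup_matrix_def)
qed

text \<open>At positions that are not nonconstant the left side is zero by definition; a nonzero
  term on the right would concatenate two nonconstant paths into a nonconstant one.\<close>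

lemma dup_matrix_path_act:
  assumes m: "m \<in> rad_matrices" and n: "n \<in> rad_matrices"
  shows "dup_matrix (\<lambda>s. path_act S m (n s)) s = path_act dup.S (dup_matrix m) (dup_matrix n s)"
proof (intro ext)
  fix u r
  show "dup_matrix (\<lambda>s. path_act S m (n s)) s u r = path_act dup.S (dup_matrix m) (dup_matrix n s) u r"
  proof (cases "dup.nonconstant s u r")
    case True then show ?thesis using dup_matrix_mult[OF m n] by simp
  next
    case False
    have "path_act dup.S (dup_matrix m) (dup_matrix n s) u r = 0"
    proof (rule ccontr)
      assume "path_act dup.S (dup_matrix m) (dup_matrix n s) u r \<noteq> 0"
      then obtain t k where "dup_matrix n s t (drop k r) \<noteq> 0" "dup_matrix m t u (take k r) \<noteq> 0"
        by (rule path_act_nonzeroE)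
      then have "dup.nonconstant s t (drop k r)" "dup.nonconstant t u (take k r)"
        by (auto simp: dup_matrix_def split: if_splits)
      then have "dup.nonconstant s u (take k r @ drop k r)"
        using dup.awalk_appendI unfolding dup.nonconstant_def by blast
      with False show False by simp
    qed
    then show ?thesis using False by (simp add: dup_matrix_def)
  qed
qed

section \<open>The isomorphism of radicals\<close>

lemma ideal_iso_dup: "ideal_iso A (jacobson_radical A) dup.A (jacobson_radical dup.A)"
proof -
  interpret dupA: ring dup.A by (rule dup.ring_A)
  \<comment> \<open>The map is conjugated through the matrix descriptions; the guard in
    \<open>dup_matrix\<close> forces all its values into the radical.\<close>
  define \<Psi> where "\<Psi> \<phi> = dup.hom_of (dup_matrix (coef \<phi>))" for \<phi>
  have \<Psi>: "\<Psi> \<phi> \<in> dup.rad_ideal" "\<Psi> \<phi> \<in> carrier dup.A" "dup.coef (\<Psi> \<phi>) = dup_matrix (coef \<phi>)" for \<phi>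
    using dup_matrix_in_rad_matrices[of "coef \<phi>"] dup.hom_of_in_rad_ideal dup.rad_matrices_subset
    unfolding \<Psi>_def by (auto simp: dup.coef_hom_of dup.hom_of_in_carrier)
  have car: "\<phi> \<in> carrier A" if "\<phi> \<in> rad_ideal" for \<phi> using that by (simp add: rad_ideal_def)
  have "inj_on \<Psi> rad_ideal"
  proof (rule inj_onI)
    fix \<phi> \<psi> assume *: "\<phi> \<in> rad_ideal" "\<psi> \<in> rad_ideal" "\<Psi> \<phi> = \<Psi> \<psi>"
    then have "coef \<phi> = coef \<psi>" using \<Psi>(3) dup_matrix_inj coef_in_rad_matrices by metis
    then show "\<phi> = \<psi>" using * car hom_eqI by blast
  qed
  moreover have "\<phi>' \<in> \<Psi> ` rad_ideal" if "\<phi>' \<in> dup.rad_ideal" for \<phi>'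
  proof -
    from dup_matrix_surj[OF dup.coef_in_rad_matrices[OF that]]
    obtain m where m: "m \<in> rad_matrices" "dup_matrix m = dup.coef \<phi>'" .
    have "\<phi>' \<in> carrier dup.A" using that by (simp add: dup.rad_ideal_def)
    then have "\<Psi> (hom_of m) = \<phi>'"
      using m by (simp add: \<Psi>_def coef_hom_of rad_matrices_subset dup.hom_of_coef)
    then show ?thesis using hom_of_in_rad_ideal[OF m(1)] by blast
  qed
  ultimately have "bij_betw \<Psi> rad_ideal dup.rad_ideal" using \<Psi>(1) by (auto simp: bij_betw_def)
  moreover have "\<Psi> (\<phi> \<oplus>\<^bsub>A\<^esub> \<psi>) = \<Psi> \<phi> \<oplus>\<^bsub>dup.A\<^esub> \<Psi> \<psi>" for \<phi> \<psi>
    by (rule dup.hom_eqI) (auto simp: \<Psi> dup.coef_add coef_add fun_eq_iff dup_matrix_def)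
  moreover have "\<Psi> (c \<odot>\<^bsub>A\<^esub> \<phi>) = c \<odot>\<^bsub>dup.A\<^esub> \<Psi> \<phi>" if "\<phi> \<in> rad_ideal" for c \<phi>
  proof (rule dup.hom_eqI)
    show "\<Psi> (c \<odot>\<^bsub>A\<^esub> \<phi>) \<in> carrier dup.A" by (rule \<Psi>)
    show "c \<odot>\<^bsub>dup.A\<^esub> \<Psi> \<phi> \<in> carrier dup.A" using \<Psi>(2) by (rule dup.smult_closed)
    show "dup.coef (\<Psi> (c \<odot>\<^bsub>A\<^esub> \<phi>)) = dup.coef (c \<odot>\<^bsub>dup.A\<^esub> \<Psi> \<phi>)"
      using coef_smult[OF car[OF that]] dup.coef_smult[OF \<Psi>(2)]
      by (auto simp: \<Psi>(3) fun_eq_iff dup_matrix_def)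
  qed
  moreover have "\<Psi> (\<phi> \<otimes>\<^bsub>A\<^esub> \<psi>) = \<Psi> \<phi> \<otimes>\<^bsub>dup.A\<^esub> \<Psi> \<psi>" if "\<phi> \<in> rad_ideal" "\<psi> \<in> rad_ideal" for \<phi> \<psi>
  proof (rule dup.hom_eqI)
    \<comment> \<open>By \<open>coef_mult\<close> both products become instances of
      \<open>path_act\<close>, which \<open>dup_matrix_path_act\<close> relates row by row.\<close>
    have eq: "coef (\<phi> \<otimes>\<^bsub>A\<^esub> \<psi>) = (\<lambda>s. path_act S (coef \<phi>) (coef \<psi> s))"
      using coef_mult[OF car[OF that(1)] car[OF that(2)]] by blast
    show "dup.coef (\<Psi> (\<phi> \<otimes>\<^bsub>A\<^esub> \<psi>)) = dup.coef (\<Psi> \<phi> \<otimes>\<^bsub>dup.A\<^esub> \<Psi> \<psi>)"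
    proof
      fix s
      show "dup.coef (\<Psi> (\<phi> \<otimes>\<^bsub>A\<^esub> \<psi>)) s = dup.coef (\<Psi> \<phi> \<otimes>\<^bsub>dup.A\<^esub> \<Psi> \<psi>) s"
        unfolding dup.coef_mult[OF \<Psi>(2) \<Psi>(2)] \<Psi>(3) eq
        using that by (simp add: dup_matrix_path_act coef_in_rad_matrices)
    qed
  qed (use \<Psi> in auto)
  ultimately show ?thesis
    using ideal_rad_ideal dup.ideal_rad_ideal
    unfolding ideal_iso_def jacobson_radical_A dup.jacobson_radical_A by blast
qed

end

theorem theorem3p15:
  fixes Q :: "('v, 'a) pre_digraph" and v :: 'v and d :: "'v \<Rightarrow> nat"
    and K :: "'k::{field, finite} itself"
  assumes "fin_digraph Q" and "acyclic_quiver Q" and "source_vertex Q v"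
  shows "ideal_iso
           (proj_end K Q d) (jacobson_radical (proj_end K Q d))
           (proj_end K (dup_quiver Q v (d v)) (d(v := 1)))
           (jacobson_radical (proj_end K (dup_quiver Q v (d v)) (d(v := 1)))) \<and>
         commuting_count K Q d = commuting_count K (dup_quiver Q v (d v)) (d(v := 1))"
proof -
  interpret fin_digraph Q by fact
  interpret source_duplication Q d K v
  proof
    \<comment> \<open>A nonempty closed walk contains a cycle.\<close>
    show "p = []" if "awalk u p u" for u p
      using that closed_w_imp_cycle[of p] assms(2) by (auto simp: closed_w_def acyclic_quiver_def)
  qed fact
  show ?thesis
    using ideal_iso_dup ideal_iso_card_commuting_pairs[OF ideal_iso_dup]
    unfolding commuting_count_def by blast
qed

end
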